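(* Let $R(q)=\dfrac{(q;q^5)_\infty(q^4;q^5)_\infty}{(q^2;q^5)_\infty(q^3;q^5)_\infty}$ and define integers $C(n)$ by $\dfrac{R^5(q)}{R(q^5)}=\sum_{n=0}^{\infty}C(n)q^{n}$. Then for all nonnegative integers $n$, $$C(5n)<0,\quad C(5n+1)<0,\quad C(5n+2)>0,\quad C(5n+3)<0,\quad C(5n+4)>0,$$ with the sole exception $C(0)=1$.
   Context: For complex $a,q$ with $|q|<1$, $(a;q)_\infty:=\prod_{k=0}^{\infty}(1-aq^k)$. All series are power series in $q$. *)

theory Defs
  imports "HOL-Analysis.Analysis"
begin

definition qpoch_inf :: "complex \<Rightarrow> complex \<Rightarrow> complex" where
  "qpoch_inf a q = (\<Prod>k. 1 - a * q ^ k)"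

definition rogers_ramanujan_R :: "complex \<Rightarrow> complex" where
  "rogers_ramanujan_R q =
     (qpoch_inf q (q ^ 5) * qpoch_inf (q ^ 4) (q ^ 5)) /
     (qpoch_inf (q ^ 2) (q ^ 5) * qpoch_inf (q ^ 3) (q ^ 5))"

text \<open>The description below is proper: coefficients of a power series on the unit disc are
  unique, and they are integers here because every factor of the products is a power series
  with integer coefficients and constant term 1.\<close>

definition C :: "nat \<Rightarrow> int" where
  "C = (THE c. \<forall>q::complex. norm q < 1 \<longrightarrow>
          (\<lambda>n. of_int (c n) * q ^ n) sums
            (rogers_ramanujan_R q ^ 5 / rogers_ramanujan_R (q ^ 5)))"

end

theory Submission
  imports Defs "HOL-Complex_Analysis.Complex_Analysis"
begin

text \<open>
  Write \<open>Q = q\<^sup>5\<close>, \<open>w = q R(Q)\<close> and \<open>V = q R(q)\<^sup>5\<close>. Expanding two Jacobi triple products gives the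
  5-dissection of \<open>(q;q)\<^sub>\<infinity>\<close> in the form of a product formula for \<open>1 - w - w\<^sup>2\<close>, and multiplying
  over the fifth roots of unity gives one for \<open>1 - 11 w\<^sup>5 - w\<^sup>1\<^sup>0\<close>, equivalently for \<open>1 - 11 V - V\<^sup>2\<close>.
  Together they yield a quadratic equation for \<open>V\<close> over the polynomials in \<open>w\<close>, one of whose roots
  is excluded near \<open>q = 0\<close>; hence \<open>V = w N(w) / D(w)\<close> with
  \<open>N D (1 - w - w\<^sup>2) = 1 - 11 w\<^sup>5 - w\<^sup>1\<^sup>0\<close>. So the quotient in question is
  \<open>N(w)\<^sup>2 (1 - w - w\<^sup>2) / (1 - 11 w\<^sup>5 - w\<^sup>1\<^sup>0)\<close>, whose denominator is a series in \<open>Q\<close>, and the powers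
  of \<open>w\<close> in the numerator separate the residue classes modulo 5. Four of the five classes are visibly
  of one sign, being combinations of the partition products \<open>A = 1/(Q,Q\<^sup>4;Q\<^sup>5)\<^sub>\<infinity>\<close> and
  \<open>B = 1/(Q\<^sup>2,Q\<^sup>3;Q\<^sup>5)\<^sub>\<infinity>\<close>. The class of 1 is
  \<open>A\<^sup>1\<^sup>0B\<^sup>2 - 3QA\<^sup>5B\<^sup>7 = B (1/A + 8QA\<^sup>5B\<^sup>6) + Q\<^sup>2B\<^sup>1\<^sup>2\<close>, where the coefficients of \<open>1/A\<close> are bounded in
  absolute value by those of \<open>A\<close>, hence by those of \<open>1 + Q A/(1-Q)\<close>.
\<close>


section \<open>Tannery's theorem for sums over an arbitrary index set\<close>

lemma has_sum_dominated_convergence: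
  fixes f :: "nat \<Rightarrow> 'i \<Rightarrow> complex"
  assumes "\<And>n j. norm (f n j) \<le> g j" and "g summable_on UNIV"
    and "\<And>j. (\<lambda>n. f n j) \<longlonglongrightarrow> h j"
    and "\<And>n. (f n has_sum S n) UNIV" and "S \<longlonglongrightarrow> L"
  shows "(h has_sum L) UNIV"
proof -
  have g0: "0 \<le> g j" for j
    using assms(1)[of 0 j] norm_ge_zero order_trans by blast
  have hb: "norm (h j) \<le> g j" for j
    by (rule tendsto_upperbound[OF tendsto_norm[OF assms(3)]]) (use assms(1) in auto)
  have abs: "(\<lambda>j. norm (k j)) summable_on UNIV" if "\<And>j. norm (k j) \<le> g j" for k :: "'i \<Rightarrow> complex"
    by (rule summable_on_comparison_test[OF assms(2)]) (use that in auto)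
  \<comment> \<open>An absolutely convergent sum is the integral against counting measure, so that
    Lebesgue's dominated convergence theorem applies.\<close>
  have int: "integral\<^sup>L (count_space UNIV) k = infsum k UNIV" if "\<And>j. norm (k j) \<le> g j" for k :: "'i \<Rightarrow> complex"
    using infsetsum_infsum[of k UNIV] abs[OF that] abs_summable_equivalent[of k UNIV]
    by (simp add: infsetsum_def)
  have gi: "integrable (count_space UNIV) g"
    using assms(2) g0 abs_summable_equivalent[of g UNIV]
    by (simp add: Infinite_Set_Sum.abs_summable_on_def)
  have "(\<lambda>n. integral\<^sup>L (count_space UNIV) (f n)) \<longlonglongrightarrow> integral\<^sup>L (count_space UNIV) h"
    by (rule integral_dominated_convergence[OF _ _ gi]) (use assms in auto)
  moreover have "integral\<^sup>L (count_space UNIV) (f n) = S n" for n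
    using int[of "f n"] assms(1,4) infsumI by metis
  ultimately have "infsum h UNIV = L"
    using int[of h] hb assms(5) LIMSEQ_unique by force
  moreover have "h summable_on UNIV"
    using abs[of h] hb abs_summable_summable by blast
  ultimately show ?thesis by auto
qed

section \<open>Triangular numbers, the exponents of all the theta series\<close>

definition tri :: "int \<Rightarrow> nat" where "tri j = nat (j * (j + 1) div 2)"

lemma two_tri: "2 * int (tri j) = j * (j + 1)"
proof -
  have "j * (j + 1) \<ge> 0" by (cases "j \<ge> 0") (auto simp: mult_nonpos_nonpos)
  moreover have "even (j * (j + 1))" by simp
  ultimately show ?thesis unfolding tri_def by (simp add: pos_imp_zdiv_nonneg_iff)
qed

lemma tri_eqI: "2 * int n = j * (j + 1) \<Longrightarrow> tri j = n"
  using two_tri[of j] by linarith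

lemma tri_minus: "tri (- j) = tri (j - 1)"
  by (rule tri_eqI) (simp add: two_tri algebra_simps)

lemma tri_0 [simp]: "tri 0 = 0" and tri_m1 [simp]: "tri (-1) = 0"
  by (simp_all add: tri_def)

subsection \<open>Infinite q-Pochhammer symbols\<close>

lemma convergent_prod_qpoch:
  fixes a q :: complex
  assumes "norm q < 1"
  shows "convergent_prod (\<lambda>k. 1 - a * q ^ k)"
proof -
  have "summable (\<lambda>k. norm a * norm q ^ k)"
    by (intro summable_mult summable_geometric) (use assms in auto)
  hence "summable (\<lambda>k. norm (1 - a * q ^ k - 1))"
    by (simp add: norm_mult norm_power)
  thus ?thesis
    by (intro abs_convergent_prod_imp_convergent_prod summable_imp_abs_convergent_prod)
qed

lemma qpoch_inf_LIMSEQ: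
  assumes "norm q < 1"
  shows "(\<lambda>n. \<Prod>k<n. 1 - a * q ^ k) \<longlonglongrightarrow> qpoch_inf a q"
  unfolding qpoch_inf_def
  using convergent_prod_LIMSEQ[OF convergent_prod_qpoch[OF assms, of a]] LIMSEQ_lessThan_iff_atMost by blast

lemma qpoch_inf_nonzero:
  assumes "norm a < 1" "norm q < 1"
  shows "qpoch_inf a q \<noteq> 0"
  unfolding qpoch_inf_def
proof (rule prodinf_nonzero[OF convergent_prod_qpoch[OF assms(2)]])
  fix k
  have "norm (a * q ^ k) \<le> norm a * 1"
    unfolding norm_mult norm_power using assms by (intro mult_left_mono power_le_one) auto
  thus "1 - a * q ^ k \<noteq> 0" using assms by auto
qed

subsection \<open>The Jacobi triple product\<close>

definition qfact :: "complex \<Rightarrow> nat \<Rightarrow> complex" where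
  "qfact q n = (\<Prod>i<n. 1 - q * q ^ i)"

text \<open>The Gaussian binomial coefficient [m+n choose n+j], indexed from its centre. Keeping
  \<open>m\<close> and \<open>n\<close> separate lets the two finite products grow one factor at a
  time, and the value 0 out of range lets every sum run over all integers.\<close>

definition qbinom :: "complex \<Rightarrow> nat \<Rightarrow> nat \<Rightarrow> int \<Rightarrow> complex" where
  "qbinom q m n j = (if - int n \<le> j \<and> j \<le> int m
     then qfact q (m + n) / (qfact q (nat (n + j)) * qfact q (nat (m - j))) else 0)"

lemma qfact_0 [simp]: "qfact q 0 = 1" and qfact_Suc: "qfact q (Suc n) = qfact q n * (1 - q ^ Suc n)"
  by (simp_all add: qfact_def)

lemma norm_mult_power_less_1:
  fixes q :: complex
  assumes "norm q < 1"
  shows "norm (q * q ^ i) < 1"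
  using assms power_Suc_less_one[of "norm q" i] by (cases "q = 0") (auto simp: norm_mult norm_power)

lemma qfact_nonzero: "norm q < 1 \<Longrightarrow> qfact q n \<noteq> 0"
  unfolding qfact_def using norm_mult_power_less_1[of q] by (auto simp: prod_zero_iff) (metis norm_one order_less_irrefl)

lemma qbinom_commute: "qbinom q m n j = qbinom q n m (- j)"
  by (auto simp: qbinom_def add.commute mult.commute)

text \<open>The q-Pascal rule with top m + n and bottom n + j. At j = - n and at j = m + 1 one of
  the two terms on the right vanishes; beyond m + 1 all three coefficients are 0, so the truncation
  in \<open>nat\<close> does no harm.\<close>

lemma qbinom_Suc:
  assumes "norm q < 1"
  shows "qbinom q (Suc m) n j = qbinom q m n j + q ^ nat (int m + 1 - j) * qbinom q m n (j - 1)"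
proof -
  note nz = qfact_nonzero[OF assms]
  consider "j < - int n" | "j = - int n" | "j > int m + 1" | "j = int m + 1"
    | "- int n < j" "j \<le> int m" by linarith
  thus ?thesis
  proof cases
    case 2
    thus ?thesis using nz by (simp add: qbinom_def nat_add_distrib add.commute)
  next
    case 4
    have "nat (int n + (int m + 1)) = Suc (m + n)" "nat (int n + int m) = m + n" by auto
    with 4 nz show ?thesis by (simp add: qbinom_def)
  next
    case 5
    define k where "k = nat (int n + j - 1)"
    define l where "l = nat (int m - j)"
    have e: "nat (int n + j) = Suc k" "nat (int (Suc m) - j) = Suc l" "nat (int m - j) = l" "m + n = Suc (k + l)"
       "nat (int n + (j - 1)) = k" "nat (int m - (j - 1)) = Suc l" "nat (int m + 1 - j) = Suc l"
       "Suc m + n = Suc (Suc (k + l))" "nat (1 + int m - j) = Suc l"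
      using 5 by (auto simp: k_def l_def)
    have nz': "1 - q ^ Suc i \<noteq> 0" for i using nz[of "Suc i"] by (simp add: qfact_Suc)
    have *: "qfact q (Suc (Suc (k + l))) / (qfact q (Suc k) * qfact q (Suc l)) = 
       qfact q (Suc (k+l)) / (qfact q (Suc k) * qfact q l)
       + q ^ Suc l * (qfact q (Suc (k + l)) / (qfact q k * qfact q (Suc l)))"
    proof -
      define x y P where "x = q ^ Suc k" and "y = q ^ Suc l" and "P = qfact q (Suc (k + l))"
      have xy: "q ^ Suc (Suc (k + l)) = x * y" by (simp add: x_def y_def power_add)
      have "qfact q (Suc (Suc (k + l))) = P * (1 - x * y)"
        unfolding P_def xy[symmetric] by (rule qfact_Suc)
      moreover have "qfact q (Suc k) = qfact q k * (1 - x)" "qfact q (Suc l) = qfact q l * (1 - y)"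
        unfolding x_def y_def by (rule qfact_Suc)+
      moreover have "1 - x \<noteq> 0" "1 - y \<noteq> 0" unfolding x_def y_def by (rule nz')+
      ultimately show ?thesis using nz[of k] nz[of l]
        unfolding y_def[symmetric] P_def[symmetric] by (simp add: divide_simps) (simp add: algebra_simps)
    qed
    show ?thesis using 5 * by (simp add: qbinom_def e)
  qed (auto simp: qbinom_def)
qed

text \<open>The general term of Ramanujan's theta function f(-a,-b). In this two-variable form,
  reflecting j just exchanges a and b.\<close>

definition theta_term :: "complex \<Rightarrow> complex \<Rightarrow> int \<Rightarrow> complex" where
  "theta_term a b j = (-1) powi j * a ^ tri j * b ^ tri (j - 1)"

lemma theta_term_commute: "theta_term a b j = theta_term b a (- j)"
proof -
  have "tri (- (j + 1)) = tri j" using tri_minus[of "j + 1"] by simp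
  moreover have "- (j + 1) = - j - 1" by simp
  ultimately have "tri (- j - 1) = tri j" by (simp only:)
  moreover have "(-1 :: complex) powi (- j) = (-1) powi j"
    by (simp add: power_int_minus flip: power_int_inverse)
  ultimately show ?thesis by (simp add: theta_term_def tri_minus)
qed

text \<open>A count of the exponents of a and of b. It turns the power of q = a b in the q-Pascal
  rule into the step from index j to j - 1, at the cost of a factor that does not depend on
  j.\<close>

lemma theta_term_shift:
  assumes "j \<le> int m + 1"
  shows "theta_term a b j * (a * b) ^ nat (int m + 1 - j) = - (a * (a * b) ^ m) * theta_term a b (j - 1)"
proof -
  have 1: "tri j + nat (int m + 1 - j) = tri (j - 1) + 1 + m"
  proof -
    have "2 * (int (tri j) + (int m + 1 - j)) = 2 * (int (tri (j-1)) + 1 + int m)"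
      using two_tri[of j] two_tri[of "j - 1"] by (simp add: algebra_simps)
    hence "int (tri j + nat (int m + 1 - j)) = int (tri (j - 1) + 1 + m)" using assms by simp
    thus ?thesis by (simp only: of_nat_eq_iff)
  qed
  have 2: "tri (j - 1) + nat (int m + 1 - j) = tri (j - 1 - 1) + m"
  proof -
    have "2 * (int (tri (j - 1)) + (int m + 1 - j)) = 2 * (int (tri (j-1-1)) + int m)"
      using two_tri[of "j-1"] two_tri[of "j - 1 - 1"] by (simp add: algebra_simps)
    hence "int (tri (j - 1) + nat (int m + 1 - j)) = int (tri (j - 1 - 1) + m)" using assms by simp
    thus ?thesis by (simp only: of_nat_eq_iff)
  qed
  have s: "(-1 :: complex) powi j = - ((-1) powi (j - 1))"
    using power_int_add[of "-1 :: complex" "j - 1" 1] by simp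
  have "theta_term a b j * (a * b) ^ nat (int m + 1 - j)
    = (-1) powi j * a ^ (tri j + nat (int m + 1 - j)) * b ^ (tri (j - 1) + nat (int m + 1 - j))"
    by (simp add: theta_term_def power_add power_mult_distrib mult_ac)
  also have "\<dots> = - (a * (a * b) ^ m) * theta_term a b (j - 1)"
    unfolding 1 2 s by (simp add: theta_term_def power_add power_mult_distrib mult_ac)
  finally show ?thesis .
qed

text \<open>By the q-Pascal rule and \<open>theta_term_shift\<close>, the new series is the old one
  minus a (a b)^m times its translate by one index, and both have the sum S.\<close>

lemma finite_triple_product_step:
  assumes q: "norm (a * b) < 1"
    and S: "((\<lambda>j. qbinom (a * b) m n j * theta_term a b j) has_sum S) UNIV"
  shows "((\<lambda>j. qbinom (a * b) (Suc m) n j * theta_term a b j) has_sum (S * (1 - a * (a * b) ^ m))) UNIV"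
proof -
  have "bij (\<lambda>j::int. j - 1)"
    by (rule bij_betw_byWitness[where f' = "\<lambda>j. j + 1"]) auto
  hence "((\<lambda>j. qbinom (a * b) m n (j-1) * theta_term a b (j-1)) has_sum S) UNIV"
    using S has_sum_reindex_bij_betw[of "\<lambda>j. j - 1" UNIV UNIV "\<lambda>j. qbinom (a * b) m n j * theta_term a b j"] by simp
  hence "((\<lambda>j. qbinom (a * b) m n j * theta_term a b j + (- (a * (a * b) ^ m)) * (qbinom (a * b) m n (j-1) * theta_term a b (j-1)))
     has_sum (S + (- (a * (a * b) ^ m)) * S)) UNIV"
    by (intro has_sum_add has_sum_cmult_right S)
  moreover have "qbinom (a * b) m n j * theta_term a b j + (- (a * (a * b) ^ m)) * (qbinom (a * b) m n (j-1) * theta_term a b (j-1))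
      = qbinom (a * b) (Suc m) n j * theta_term a b j" for j
  proof (cases "j \<le> int m + 1")
    case True
    have "(X + Y * Z) * t = X * t + Z * u" if "t * Y = u" for X Y Z t u :: complex
      unfolding that[symmetric] by (simp add: algebra_simps)
    from this[OF theta_term_shift[OF True, of a b], of "qbinom (a * b) m n j" "qbinom (a * b) m n (j - 1)"] show ?thesis unfolding qbinom_Suc[OF q] by (simp add: mult_ac)
  next
    case False
    thus ?thesis unfolding qbinom_Suc[OF q] by (simp add: qbinom_def)
  qed
  moreover have "S + (- (a * (a * b) ^ m)) * S = S * (1 - a * (a * b) ^ m)" by (simp only: ring_distribs) simp
  ultimately show ?thesis by (simp only:)
qed

lemma finite_triple_product_aux:
  assumes "norm (a * b) < 1"
    and S: "((\<lambda>j. qbinom (a * b) 0 n j * theta_term a b j) has_sum S) UNIV"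
  shows "((\<lambda>j. qbinom (a * b) m n j * theta_term a b j) has_sum (S * (\<Prod>k<m. 1 - a * (a * b) ^ k))) UNIV"
proof (induction m)
  case (Suc m)
  show ?case using finite_triple_product_step[OF assms(1) Suc] by (simp add: mult_ac)
qed (use S in simp)

text \<open>Only growth in \<open>m\<close> has been treated. The factors in b come from the same
  induction with a and b exchanged, started at m = n = 0, followed by the reflection of j.\<close>

lemma finite_triple_product:
  assumes q: "norm (a * b) < 1"
  shows "((\<lambda>j. qbinom (a * b) m n j * theta_term a b j)
           has_sum ((\<Prod>k<n. 1 - b * (a * b) ^ k) * (\<Prod>k<m. 1 - a * (a * b) ^ k))) UNIV"
proof (rule finite_triple_product_aux[OF q])
  have q': "norm (b * a) < 1" using q by (simp add: mult.commute)
  have "((\<lambda>j. qbinom (b * a) 0 0 j * theta_term b a j) has_sum 1) UNIV"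
    by (rule has_sum_finite_neutralI[of "{0}"]) (auto simp: qbinom_def theta_term_def)
  from finite_triple_product_aux[OF q' this, of n]
  have "((\<lambda>j. qbinom (b * a) n 0 j * theta_term b a j) has_sum (\<Prod>k<n. 1 - b * (b * a) ^ k)) UNIV"
    by simp
  moreover have "bij (uminus :: int \<Rightarrow> int)"
    by (rule bij_betw_byWitness[where f' = uminus]) auto
  ultimately have "((\<lambda>j. qbinom (b * a) n 0 (- j) * theta_term b a (- j)) has_sum (\<Prod>k<n. 1 - b * (b * a) ^ k)) UNIV"
    using has_sum_reindex_bij_betw[of uminus UNIV UNIV "\<lambda>j. qbinom (b * a) n 0 j * theta_term b a j"] by simp
  thus "((\<lambda>j. qbinom (a * b) 0 n j * theta_term a b j) has_sum (\<Prod>k<n. 1 - b * (a * b) ^ k)) UNIV"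
    by (simp add: qbinom_commute[of _ 0 n] theta_term_commute[of a b] mult.commute[of b a])
qed

lemma summable_on_int_power_abs:
  fixes r :: real
  assumes "0 \<le> r" "r < 1"
  shows "(\<lambda>j::int. r ^ nat \<bar>j\<bar>) summable_on UNIV"
proof -
  have s: "(\<lambda>n::nat. r ^ n) summable_on UNIV"
    using assms by (intro norm_summable_imp_summable_on) (auto intro!: summable_geometric)
  have 1: "(\<lambda>j::int. r ^ nat \<bar>j\<bar>) summable_on range int"
    by (subst summable_on_reindex) (use s in \<open>auto simp: o_def\<close>)
  have 2: "(\<lambda>j::int. r ^ nat \<bar>j\<bar>) summable_on range (\<lambda>n. - int n)"
    by (subst summable_on_reindex) (use s in \<open>auto simp: o_def inj_def\<close>)
  have "(UNIV :: int set) = range int \<union> (range (\<lambda>n. - int n) - range int)"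
  proof -
    have "x \<in> range int \<union> range (\<lambda>n. - int n)" for x :: int
      by (cases "x \<ge> 0") (auto intro: range_eqI[of _ _ "nat \<bar>x\<bar>"])
    thus ?thesis by auto
  qed
  moreover have "(\<lambda>j::int. r ^ nat \<bar>j\<bar>) summable_on (range int \<union> (range (\<lambda>n. - int n) - range int))"
    by (rule summable_on_Un_disjoint[OF 1 summable_on_subset_banach[OF 2]]) auto
  ultimately show ?thesis by simp
qed

lemma theta_term_summable:
  assumes "norm a < 1" "norm b < 1"
  shows "(\<lambda>j. norm (theta_term a b j)) summable_on UNIV"
proof -
  define r where "r = max (norm a) (norm b)"
  have r: "0 \<le> r" "r < 1" using assms by (auto simp: r_def le_max_iff_disj)
  have bd: "norm (theta_term a b j) \<le> r ^ nat \<bar>j\<bar>" for j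
  proof -
    have "norm (theta_term a b j) = norm a ^ tri j * norm b ^ tri (j - 1)"
      by (simp add: theta_term_def norm_mult norm_power norm_power_int)
    also have "\<dots> \<le> r ^ tri j * r ^ tri (j - 1)"
      using r by (intro mult_mono power_mono zero_le_power) (auto simp: r_def)
    also have "\<dots> = r ^ (tri j + tri (j - 1))" by (simp add: power_add)
    also have "\<dots> \<le> r ^ nat \<bar>j\<bar>"
    proof (rule power_decreasing)
      have "int (tri j + tri (j - 1)) = j * j"
        using two_tri[of j] two_tri[of "j-1"] by (simp add: algebra_simps)
      moreover have "\<bar>j\<bar> \<le> j * j"
      proof (cases "j = 0")
        case False
        hence "\<bar>j\<bar> * 1 \<le> \<bar>j\<bar> * \<bar>j\<bar>" by (intro mult_left_mono) auto
        thus ?thesis by simp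
      qed simp
      ultimately show "nat \<bar>j\<bar> \<le> tri j + tri (j - 1)" by linarith
    qed (use r in auto)
    finally show ?thesis .
  qed
  show ?thesis
    by (rule summable_on_comparison_test[OF summable_on_int_power_abs[OF r]]) (use bd in auto)
qed

text \<open>Let m = n tend to infinity in the finite form. For fixed j the Gaussian binomial tends
  to 1/(q;q)_inf with q = a b; since the finite products (q;q)_n and their reciprocals are bounded,
  a constant multiple of the absolute theta series dominates.\<close>

theorem jacobi_triple_product:
  assumes a: "norm a < 1" and b: "norm b < 1"
  shows "(theta_term a b has_sum (qpoch_inf a (a * b) * qpoch_inf b (a * b) * qpoch_inf (a * b) (a * b))) UNIV"
proof -
  define q where "q = a * b"
  have q: "norm q < 1"
    using mult_strict_mono'[OF a b] by (simp add: q_def norm_mult)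
  define P where "P = qpoch_inf q q"
  have P0: "P \<noteq> 0" unfolding P_def by (rule qpoch_inf_nonzero[OF q q])
  have lim: "qfact q \<longlonglongrightarrow> P"
    unfolding P_def qfact_def by (rule qpoch_inf_LIMSEQ[OF q])
  obtain K where K: "\<And>n. norm (qfact q n) \<le> K"
    using convergent_imp_Bseq[OF convergentI[OF lim]] by (meson Bseq_def)
  have lim': "(\<lambda>n. inverse (qfact q n)) \<longlonglongrightarrow> inverse P"
    by (intro tendsto_inverse lim P0)
  obtain K' where K': "\<And>n. norm (inverse (qfact q n)) \<le> K'"
    using convergent_imp_Bseq[OF convergentI[OF lim']] by (meson Bseq_def)
  have K0: "K \<ge> 0" "K' \<ge> 0" using K[of 0] K'[of 0] by auto
  define f where "f = (\<lambda>n j. qbinom q n n j * theta_term a b j)"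
  have bound: "norm (f n j) \<le> (K * (K' * K')) * norm (theta_term a b j)" for n j
  proof -
    have "norm (qbinom q n n j) \<le> K * (K' * K')"
    proof (cases "- int n \<le> j \<and> j \<le> int n")
      case True
      hence "qbinom q n n j = qfact q (n + n) * (inverse (qfact q (nat (n + j))) * inverse (qfact q (nat (n - j))))"
        by (simp add: qbinom_def field_simps)
      thus ?thesis using K K' K0 by (simp only: norm_mult) (intro mult_mono mult_nonneg_nonneg, auto)
    qed (use K0 in \<open>auto simp: qbinom_def\<close>)
    thus ?thesis unfolding f_def norm_mult by (intro mult_right_mono) auto
  qed
  have "((\<lambda>j. inverse P * theta_term a b j) has_sum (qpoch_inf b q * qpoch_inf a q)) UNIV"
  proof (rule has_sum_dominated_convergence[OF bound])
    show "(\<lambda>j. (K * (K' * K')) * norm (theta_term a b j)) summable_on UNIV"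
      by (intro summable_on_cmult_right theta_term_summable a b)
    show "(f n has_sum ((\<Prod>k<n. 1 - b * q ^ k) * (\<Prod>k<n. 1 - a * q ^ k))) UNIV" for n
      unfolding f_def q_def by (rule finite_triple_product) (use q in \<open>simp add: q_def\<close>)
    show "(\<lambda>n. (\<Prod>k<n. 1 - b * q ^ k) * (\<Prod>k<n. 1 - a * q ^ k)) \<longlonglongrightarrow> qpoch_inf b q * qpoch_inf a q"
      by (intro tendsto_mult qpoch_inf_LIMSEQ q)
    fix j :: int
    have F1: "filterlim (\<lambda>n. n + n) sequentially sequentially"
      by (rule filterlim_subseq) (auto simp: strict_mono_def)
    have F2: "filterlim (\<lambda>n. nat (int n + i)) sequentially sequentially" for i :: int
      unfolding filterlim_at_top
    proof
      fix Z :: nat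
      show "\<forall>\<^sub>F n in sequentially. Z \<le> nat (int n + i)"
        using eventually_ge_at_top[of "Z + nat \<bar>i\<bar>"] by eventually_elim linarith
    qed
    have "(\<lambda>n. qfact q (n + n) * (inverse (qfact q (nat (int n + j))) * inverse (qfact q (nat (int n + - j)))) * theta_term a b j)
       \<longlonglongrightarrow> P * (inverse P * inverse P) * theta_term a b j"
      by (intro tendsto_mult filterlim_compose[OF lim F1] filterlim_compose[OF lim' F2] tendsto_const)
    moreover have "\<forall>\<^sub>F n in sequentially. qfact q (n + n) * (inverse (qfact q (nat (int n + j))) * inverse (qfact q (nat (int n + - j)))) * theta_term a b j = f n j"
      using eventually_ge_at_top[of "nat \<bar>j\<bar>"]
      by eventually_elim (auto simp: f_def qbinom_def divide_inverse)
    ultimately have "(\<lambda>n. f n j) \<longlonglongrightarrow> P * (inverse P * inverse P) * theta_term a b j"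
      by (rule Lim_transform_eventually)
    moreover have "P * (inverse P * inverse P) * theta_term a b j = inverse P * theta_term a b j" using P0 by simp
    ultimately show "(\<lambda>n. f n j) \<longlonglongrightarrow> inverse P * theta_term a b j" by (simp only:)
  qed
  hence "((\<lambda>j. P * (inverse P * theta_term a b j)) has_sum (P * (qpoch_inf b q * qpoch_inf a q))) UNIV"
    by (rule has_sum_cmult_right)
  moreover have "(\<lambda>j. P * (inverse P * theta_term a b j)) = theta_term a b"
    using P0 by (simp add: fun_eq_iff)
  moreover have "P * (qpoch_inf b q * qpoch_inf a q) = qpoch_inf a q * qpoch_inf b q * qpoch_inf q q"
    by (simp add: P_def)
  ultimately show ?thesis unfolding q_def by simp
qed


section \<open>Products of unconditionally convergent complex series\<close>

lemma has_sum_prod_complex: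
  fixes f :: "'a \<Rightarrow> complex" and g :: "'b \<Rightarrow> complex"
  assumes "(f has_sum S) A" "(g has_sum T) B"
  shows "((\<lambda>(x, y). f x * g y) has_sum (S * T)) (A \<times> B)"
proof (rule has_sum_SigmaI)
  show "((\<lambda>y. case (x, y) of (x, y) \<Rightarrow> f x * g y) has_sum (f x * T)) B" for x
    using has_sum_cmult_right[OF assms(2), of "f x"] by simp
  show "((\<lambda>x. f x * T) has_sum (S * T)) A"
    by (rule has_sum_cmult_left[OF assms(1)])
  have f: "(\<lambda>x. norm (f x)) summable_on A" and g: "(\<lambda>x. norm (g x)) summable_on B"
    using assms summable_on_iff_abs_summable_on_complex by (auto simp: summable_on_def)
  have "(\<lambda>z. norm (case z of (x, y) \<Rightarrow> f x * g y)) summable_on (A \<times> B)"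
  proof (subst Infinite_Sum.abs_summable_on_Sigma_iff, intro conjI ballI)
    show "(\<lambda>y. norm (case (x, y) of (x, y) \<Rightarrow> f x * g y)) summable_on B" for x
      using summable_on_cmult_right[OF g, of "norm (f x)"] by (simp add: norm_mult)
    show "(\<lambda>x. norm (\<Sum>\<^sub>\<infinity>y\<in>B. norm (case (x, y) of (x, y) \<Rightarrow> f x * g y))) summable_on A"
    proof -
      have "norm (\<Sum>\<^sub>\<infinity>y\<in>B. norm (case (x, y) of (x, y) \<Rightarrow> f x * g y)) = norm (f x) * (\<Sum>\<^sub>\<infinity>y\<in>B. norm (g y))" for x
        by (simp add: norm_mult infsum_cmult_right' abs_mult infsum_nonneg)
      thus ?thesis using summable_on_cmult_left[OF f] by simp
    qed
  qed
  thus "(\<lambda>(x, y). f x * g y) summable_on (A \<times> B)"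
    by (rule abs_summable_summable)
qed

subsection \<open>A quintic identity for theta products\<close>

definition poch5 :: "nat \<Rightarrow> complex \<Rightarrow> complex" where
  "poch5 a q = qpoch_inf (q ^ a) (q ^ 5)"

lemma norm_power_less_1:
  fixes q :: complex
  assumes "norm q < 1" "a > 0"
  shows "norm (q ^ a) < 1"
  using assms by (simp add: norm_power power_less_one_iff)

text \<open>\<open>theta1\<close> and \<open>theta2\<close> are Ramanujan's f(-q,-q^4) and
  f(-q^2,-q^3). Their quotient is R(q), and their product is (q;q)_inf (q^5;q^5)_inf.\<close>

definition theta1 :: "complex \<Rightarrow> complex" where
  "theta1 q = poch5 1 q * poch5 4 q * poch5 5 q"

definition theta2 :: "complex \<Rightarrow> complex" where
  "theta2 q = poch5 2 q * poch5 3 q * poch5 5 q"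

lemma theta1_has_sum:
  assumes "norm q < 1"
  shows "(theta_term (q ^ 4) q has_sum theta1 q) UNIV"
proof -
  have e: "q ^ 4 * q = q ^ 5" using power_Suc2[of q 4] by simp
  show ?thesis
    using jacobi_triple_product[of "q ^ 4" q] norm_power_less_1[OF assms, of 4] assms
    unfolding e by (simp add: theta1_def poch5_def mult_ac)
qed

lemma theta2_has_sum:
  assumes "norm q < 1"
  shows "(theta_term (q ^ 3) (q ^ 2) has_sum theta2 q) UNIV"
  using jacobi_triple_product[of "q ^ 3" "q ^ 2"] norm_power_less_1[OF assms, of 3] norm_power_less_1[OF assms, of 2]
  by (simp add: theta2_def poch5_def power_add[symmetric] mult_ac)

definition tri_term :: "complex \<Rightarrow> int \<Rightarrow> complex" where
  "tri_term q u = (-1) powi u * q ^ tri u"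

text \<open>Triangular numbers are symmetric about -1/2 while the sign changes. This antisymmetry
  later pairs the residue classes modulo 5 and kills the class of 2, which it maps to
  itself.\<close>

lemma tri_term_reflect: "tri_term q (- 1 - u) = - tri_term q u"
proof -
  have "tri (- 1 - u) = tri u" using two_tri[of u] by (intro tri_eqI) (simp add: algebra_simps)
  moreover have "(-1 :: complex) powi (- 1 - u) = - ((-1) powi u)"
    by (auto simp: power_int_minus_left)
  ultimately show ?thesis by (simp add: tri_term_def)
qed

text \<open>The substitution u = 2m - n, v = m + 2n is multiplication of m + i n by 2 + i, so u^2 +
  v^2 = 5 (m^2 + n^2), while u + v = 3m + n accounts for the linear terms. The exponent thus
  separates into one triangular number in u and one in v.\<close>

lemma theta_term_mult:
  "theta_term (q ^ 4) q m * theta_term (q ^ 3) (q ^ 2) n = tri_term q (2 * m - n) * tri_term q (m + 2 * n)"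
proof -
  have "int (4 * tri m + tri (m - 1) + (3 * tri n + 2 * tri (n - 1))) = int (tri (2 * m - n) + tri (m + 2 * n))"
    using two_tri[of m] two_tri[of "m - 1"] two_tri[of n] two_tri[of "n - 1"] two_tri[of "2 * m - n"] two_tri[of "m + 2 * n"]
    by (simp add: algebra_simps)
  hence e: "4 * tri m + tri (m - 1) + (3 * tri n + 2 * tri (n - 1)) = tri (2 * m - n) + tri (m + 2 * n)"
    by (simp only: of_nat_eq_iff)
  have "(-1 :: complex) powi m * (-1) powi n = (-1) powi (2 * m - n) * (-1) powi (m + 2 * n)"
    by (auto simp: power_int_minus_left)
  moreover have "(q ^ 4) ^ tri m * q ^ tri (m - 1) * ((q ^ 3) ^ tri n * (q ^ 2) ^ tri (n - 1)) = 
     q ^ tri (2 * m - n) * q ^ tri (m + 2 * n)"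
    by (simp only: power_mult[symmetric] power_add[symmetric] e)
  moreover have "theta_term (q ^ 4) q m * theta_term (q ^ 3) (q ^ 2) n =
      ((-1) powi m * (-1) powi n) * ((q ^ 4) ^ tri m * q ^ tri (m - 1) * ((q ^ 3) ^ tri n * (q ^ 2) ^ tri (n - 1)))"
    unfolding theta_term_def by (simp only: mult_ac)
  ultimately have "theta_term (q ^ 4) q m * theta_term (q ^ 3) (q ^ 2) n =
      ((-1) powi (2 * m - n) * (-1) powi (m + 2 * n)) * (q ^ tri (2 * m - n) * q ^ tri (m + 2 * n))"
    by (simp only:)
  thus ?thesis unfolding tri_term_def by (simp only: mult_ac)
qed

text \<open>The class of 0 modulo 5 reproduces the series of \<open>theta2\<close> at q^5; in
  \<open>tri_term_51\<close> the class of 1 reproduces that of \<open>theta1\<close>, times -q. By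
  reflection no other class is needed.\<close>

lemma tri_term_5: "tri_term q (5 * s) = theta_term ((q ^ 5) ^ 3) ((q ^ 5) ^ 2) s"
proof -
  have "int (tri (5 * s)) = int (5 * (3 * tri s + 2 * tri (s - 1)))"
    using two_tri[of s] two_tri[of "s - 1"] two_tri[of "5 * s"] by (simp add: algebra_simps)
  hence "tri (5 * s) = 5 * (3 * tri s + 2 * tri (s - 1))" by (simp only: of_nat_eq_iff)
  moreover have "(-1 :: complex) powi (5 * s) = (-1) powi s" by (auto simp: power_int_minus_left)
  ultimately show ?thesis by (simp only: tri_term_def theta_term_def power_add power_mult mult.assoc)
qed

lemma tri_term_51: "tri_term q (5 * s + 1) = - q * theta_term ((q ^ 5) ^ 4) (q ^ 5) s"
proof -
  have "int (tri (5 * s + 1)) = int (1 + 5 * (4 * tri s + tri (s - 1)))"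
    using two_tri[of s] two_tri[of "s - 1"] two_tri[of "5 * s + 1"] by (simp add: algebra_simps)
  hence "tri (5 * s + 1) = 1 + 5 * (4 * tri s + tri (s - 1))" by (simp only: of_nat_eq_iff)
  moreover have "(-1 :: complex) powi (5 * s + 1) = - ((-1) powi s)" by (auto simp: power_int_minus_left)
  ultimately have "tri_term q (5 * s + 1) = - ((-1) powi s) * (q ^ 1 * (((q ^ 5) ^ 4) ^ tri s * (q ^ 5) ^ tri (s - 1)))"
    by (simp only: tri_term_def power_add power_mult)
  thus ?thesis by (simp only: theta_term_def power_one_right mult_minus_left mult_minus_right mult_ac)
qed

lemma tri_term_summable:
  assumes "norm q < 1"
  shows "tri_term q summable_on UNIV"
proof (rule abs_summable_summable)
  \<comment> \<open>The bound 1/2 keeps \<open>r\<close> positive when q = 0. A factor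
    \<open>inverse r\<close> is needed because \<open>tri u\<close> can fall short of |u| by 1, as
    at u = -1.\<close>
  define r where "r = max (norm q) (1/2)"
  have r: "0 < r" "r < 1" using assms by (auto simp: r_def)
  have bd: "norm (norm (tri_term q u)) \<le> inverse r * r ^ nat \<bar>u\<bar>" for u
  proof -
    have "\<bar>u\<bar> \<le> int (tri u) + 1"
    proof -
      \<comment> \<open>For u = - v with v > 0, \<open>tri u\<close> + 1 - |u| equals (v - 1)(v -
        2)/2, which is nonnegative at every integer v.\<close>
      have *: "(v - 1) * (v - 2) \<ge> 0" for v :: int
        by (cases "v \<le> 1") (auto intro: mult_nonpos_nonpos)
      have "2 * \<bar>u\<bar> \<le> 2 * (int (tri u) + 1)"
        using *[of "- u"] *[of u] two_tri[of u] by (cases "u \<ge> 0") (auto simp: algebra_simps)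
      thus ?thesis by simp
    qed
    hence n: "nat \<bar>u\<bar> \<le> Suc (tri u)" by linarith
    have "norm (norm (tri_term q u)) = norm q ^ tri u"
      by (simp add: tri_term_def norm_mult norm_power norm_power_int)
    also have "\<dots> \<le> r ^ tri u" by (intro power_mono) (auto simp: r_def)
    also have "\<dots> = inverse r * r ^ Suc (tri u)" using r by simp
    also have "\<dots> \<le> inverse r * r ^ nat \<bar>u\<bar>"
      using r n by (intro mult_left_mono power_decreasing) auto
    finally show ?thesis .
  qed
  have sm: "(\<lambda>u::int. inverse r * r ^ nat \<bar>u\<bar>) summable_on UNIV"
    using r by (intro summable_on_cmult_right summable_on_int_power_abs) auto
  show "(\<lambda>u. norm (tri_term q u)) summable_on UNIV"
    by (rule summable_on_comparison_test[OF sm]) (use bd in auto)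
qed

definition tri_sum :: "complex \<Rightarrow> int \<Rightarrow> complex" where
  "tri_sum q r = (\<Sum>\<^sub>\<infinity>s. tri_term q (5 * s + r))"

lemma tri_sum_has_sum:
  assumes "norm q < 1"
  shows "((\<lambda>s. tri_term q (5 * s + r)) has_sum tri_sum q r) UNIV"
proof -
  have "tri_term q summable_on range (\<lambda>s. 5 * s + r)"
    by (rule summable_on_subset_banach[OF tri_term_summable[OF assms]]) auto
  hence "(\<lambda>s. tri_term q (5 * s + r)) summable_on UNIV"
    by (subst (asm) summable_on_reindex) (auto simp: inj_def o_def)
  thus ?thesis unfolding tri_sum_def by auto
qed

lemma tri_sum_shift:
  assumes "norm q < 1"
  shows "tri_sum q (r + 5 * k) = tri_sum q r"
proof -
  have "((\<lambda>s. tri_term q (5 * s + (r + 5 * k))) has_sum tri_sum q r) UNIV"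
    using tri_sum_has_sum[OF assms, of r]
    by (subst has_sum_reindex_bij_witness[of _ "\<lambda>s. s - k" "\<lambda>s. s + k" UNIV "\<lambda>s. tri_term q (5 * s + r)" _ _ "tri_sum q r"])
       (auto simp: algebra_simps)
  thus ?thesis using tri_sum_has_sum[OF assms, of "r + 5 * k"] has_sum_unique by blast
qed

lemma tri_sum_reflect:
  assumes "norm q < 1"
  shows "tri_sum q (- 1 - r) = - tri_sum q r"
proof -
  have "((\<lambda>s. - tri_term q (5 * s + r)) has_sum - tri_sum q r) UNIV"
    using tri_sum_has_sum[OF assms, of r] by (simp add: has_sum_uminus)
  moreover have "- tri_term q (5 * s + r) = tri_term q (5 * (- s) + (- 1 - r))" for s
    using tri_term_reflect[of q "5 * s + r"] by (simp add: algebra_simps)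
  ultimately have "((\<lambda>s. tri_term q (5 * (- s) + (- 1 - r))) has_sum - tri_sum q r) UNIV"
    by simp
  hence "((\<lambda>s. tri_term q (5 * s + (- 1 - r))) has_sum - tri_sum q r) UNIV"
    by (subst has_sum_reindex_bij_witness[of _ uminus uminus UNIV "\<lambda>s. tri_term q (5 * (- s) + (- 1 - r))" _ _ "- tri_sum q r"])
       auto
  thus ?thesis using tri_sum_has_sum[OF assms, of "- 1 - r"] has_sum_unique by blast
qed

text \<open>The exponents of the two theta series combine to a sum of two triangular numbers
  \<open>tri u + tri v\<close> over the sublattice \<open>v \<equiv> 3 u (mod 5)\<close>, whose five classes modulo 5 factor.\<close>

lemma theta1_theta2_tri_sum:
  assumes "norm q < 1"
  shows "theta1 q * theta2 q = (\<Sum>r\<in>{0..4}. tri_sum q r * tri_sum q (3 * r))"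
proof -
  let ?f = "\<lambda>(m, n). theta_term (q ^ 4) q m * theta_term (q ^ 3) (q ^ 2) n"
  let ?g = "\<lambda>(r, s, t). tri_term q (5 * s + r) * tri_term q (5 * t + 3 * r)"
  have f: "(?f has_sum (theta1 q * theta2 q)) (UNIV \<times> UNIV)"
    by (rule has_sum_prod_complex[OF theta1_has_sum[OF assms] theta2_has_sum[OF assms]])
  have "(?f has_sum (theta1 q * theta2 q)) (UNIV \<times> UNIV) \<longleftrightarrow> (?g has_sum (theta1 q * theta2 q)) ({0..4::int} \<times> (UNIV \<times> UNIV))"
  proof (rule has_sum_reindex_bij_witness)
    \<comment> \<open>With u = 2m - n = 5s + r one has v = m + 2n = 3u modulo 5, so v = 5t + 3r for
      some t. Solving back, m = (2u + v)/5 and n = (2v - u)/5.\<close>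
    let ?i = "\<lambda>(r, s, t). (2 * s + t + r, 2 * t - s + r) :: int \<times> int"
    let ?j = "\<lambda>(m, n). ((2 * m - n) mod 5, (2 * m - n) div 5, (m + 2 * n - 3 * ((2 * m - n) mod 5)) div 5) :: int \<times> int \<times> int"
    have key2: "5 * ((2 * m - n) div 5) = 2 * m - n - (2 * m - n) mod 5" for m n :: int
      by (simp add: minus_mod_eq_mult_div)
    have key: "5 * ((m + 2 * n - 3 * ((2 * m - n) mod 5)) div 5) = m + 2 * n - 3 * ((2 * m - n) mod 5)"
      for m n :: int
    proof -
      have "m + 2 * n - 3 * x = 5 * (n - m + 3 * d)" if "5 * d = 2 * m - n - x" for x d
        using that by algebra
      from this[OF key2] have "m + 2 * n - 3 * ((2 * m - n) mod 5) = 5 * (n - m + 3 * ((2 * m - n) div 5))" .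
      thus ?thesis by (simp only: nonzero_mult_div_cancel_left[of 5])
    qed
    show "?i (?j a) = a" for a
    proof -
      obtain m n where a: "a = (m, n)" by (cases a)
      show ?thesis using key[of m n] key2[of m n] unfolding a by simp
    qed
    show "?j a \<in> {0..4} \<times> UNIV \<times> UNIV" for a by (auto split: prod.splits)
    show "?j (?i b) = b" if "b \<in> {0..4} \<times> UNIV \<times> UNIV" for b
    proof -
      obtain r s t where b: "b = (r, s, t)" by (cases b)
      have r: "0 \<le> r" "r < 5" using that b by auto
      have 1: "2 * (2 * s + t + r) - (2 * t - s + r) = r + 5 * s" by simp
      have 2: "(r + 5 * s) mod 5 = r" "(r + 5 * s) div 5 = s" using r by auto
      have 3: "(2 * s + t + r) + 2 * (2 * t - s + r) - 3 * r = 5 * t" by simp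
      show ?thesis unfolding b by (simp only: prod.case 1 2 3) simp
    qed
    show "?g (?j a) = ?f a" for a
    proof -
      obtain m n where a: "a = (m, n)" by (cases a)
      have "5 * ((2 * m - n) div 5) + (2 * m - n) mod 5 = 2 * m - n" using key2[of m n] by simp
      moreover have "5 * ((m + 2 * n - 3 * ((2 * m - n) mod 5)) div 5) + 3 * ((2 * m - n) mod 5) = m + 2 * n"
        using key[of m n] by simp
      ultimately show ?thesis unfolding a by (simp only: prod.case theta_term_mult)
    qed
  qed auto
  with f have "(?g has_sum (theta1 q * theta2 q)) ({0..4::int} \<times> (UNIV \<times> UNIV))" by blast
  hence "((\<lambda>r. tri_sum q r * tri_sum q (3 * r)) has_sum (theta1 q * theta2 q)) {0..4}"
  proof (rule has_sum_SigmaD)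
    show "((\<lambda>y. ?g (r, y)) has_sum (tri_sum q r * tri_sum q (3 * r))) (UNIV \<times> UNIV)" for r
      using has_sum_prod_complex[OF tri_sum_has_sum[OF assms, of r] tri_sum_has_sum[OF assms, of "3 * r"]]
      by simp
  qed
  thus ?thesis by (simp add: has_sum_finite_iff)
qed

text \<open>Write T_r for \<open>tri_sum q r\<close>. Reflection gives T_4 = -T_0, T_3 = -T_1 and
  T_2 = 0, so the five products collapse to T_0^2 - T_1^2 + T_0 T_1. This is the 5-dissection of
  (q;q)_inf, up to the factor (q^5;q^5)_inf.\<close>

lemma theta1_theta2_quintic:
  assumes "norm q < 1"
  shows "theta1 q * theta2 q = theta2 (q ^ 5) ^ 2 - q * theta1 (q ^ 5) * theta2 (q ^ 5) - q ^ 2 * theta1 (q ^ 5) ^ 2"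
proof -
  have q5: "norm (q ^ 5) < 1" by (rule norm_power_less_1[OF assms]) simp
  have G0: "tri_sum q 0 = theta2 (q ^ 5)"
    using has_sum_unique[OF tri_sum_has_sum[OF assms, of 0]] theta2_has_sum[OF q5] by (simp add: tri_term_5)
  have G1: "tri_sum q 1 = - q * theta1 (q ^ 5)"
    using has_sum_unique[OF tri_sum_has_sum[OF assms, of 1] has_sum_cmult_right[OF theta1_has_sum[OF q5], of "- q", folded tri_term_51]] .
  note sh = tri_sum_shift[OF assms] and rf = tri_sum_reflect[OF assms]
  have G4: "tri_sum q 4 = - tri_sum q 0" using rf[of 0] sh[of "-1" 1] by simp
  have G3: "tri_sum q 3 = - tri_sum q 1" using rf[of 1] sh[of "-2" 1] by simp
  have G2: "tri_sum q 2 = 0" using rf[of 2] sh[of "-3" 1] by simp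
  have G6: "tri_sum q 6 = tri_sum q 1" "tri_sum q 9 = tri_sum q 4" "tri_sum q 12 = tri_sum q 2"
    using sh[of 1 1] sh[of 4 1] sh[of 2 2] by simp_all
  have "{0..4} = {0, 1, 2, 3, 4 :: int}" by auto
  hence "theta1 q * theta2 q = tri_sum q 0 * tri_sum q 0 + tri_sum q 1 * tri_sum q 3 + tri_sum q 2 * tri_sum q 6
      + tri_sum q 3 * tri_sum q 9 + tri_sum q 4 * tri_sum q 12"
    unfolding theta1_theta2_tri_sum[OF assms] by simp
  thus ?thesis unfolding G6 G4 G3 G2 G0 G1 by (simp add: algebra_simps power2_eq_square)
qed


section \<open>The Rogers-Ramanujan products as holomorphic functions\<close>

lemma poch5_nonzero: "norm q < 1 \<Longrightarrow> a > 0 \<Longrightarrow> poch5 a q \<noteq> 0"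
  unfolding poch5_def by (intro qpoch_inf_nonzero norm_power_less_1) auto

text \<open>The Weierstrass M-test with majorant r^n. The uniform limit serves twice: for holomorphy
  of the product and for convergence of its Taylor coefficients.\<close>

lemma uniform_limit_poch5:
  assumes r: "r < 1" and a: "a > 0"
  shows "uniform_limit (cball 0 r) (\<lambda>n q. \<Prod>k<n. 1 - q ^ a * (q ^ 5) ^ k) (poch5 a) sequentially"
proof (cases "r \<ge> 0")
  case True
  have "uniformly_convergent_on (cball 0 r) (\<lambda>n q :: complex. \<Prod>k<n. 1 - q ^ a * (q ^ 5) ^ k)"
  proof (rule uniformly_convergent_on_prod')
    show "uniformly_convergent_on (cball 0 r) (\<lambda>N x :: complex. \<Sum>n<N. norm (1 - x ^ a * (x ^ 5) ^ n - 1))"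
    proof (rule Weierstrass_m_test')
      fix n and x :: complex
      assume "x \<in> cball 0 r"
      hence x: "norm x \<le> r" by simp
      have "norm (norm (1 - x ^ a * (x ^ 5) ^ n - 1)) = norm x ^ (a + 5 * n)"
        by (simp add: norm_mult norm_power power_add power_mult)
      also have "\<dots> \<le> r ^ (a + 5 * n)" using x by (intro power_mono) auto
      also have "\<dots> \<le> r ^ n" using True r by (intro power_decreasing) auto
      finally show "norm (norm (1 - x ^ a * (x ^ 5) ^ n - 1)) \<le> r ^ n" .
    qed (use True r in \<open>auto intro!: summable_geometric\<close>)
  qed (auto intro!: continuous_intros)
  then obtain l where l: "uniform_limit (cball 0 r) (\<lambda>n q :: complex. \<Prod>k<n. 1 - q ^ a * (q ^ 5) ^ k) l sequentially"
    unfolding uniformly_convergent_on_def by blast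
  have "l q = poch5 a q" if "q \<in> cball 0 r" for q
  proof (rule LIMSEQ_unique[OF tendsto_uniform_limitI[OF l that]])
    show "(\<lambda>n. \<Prod>k<n. 1 - q ^ a * (q ^ 5) ^ k) \<longlonglongrightarrow> poch5 a q"
      unfolding poch5_def by (intro qpoch_inf_LIMSEQ norm_power_less_1) (use that r in auto)
  qed
  hence "uniform_limit (cball 0 r) (\<lambda>n q. \<Prod>k<n. 1 - q ^ a * (q ^ 5) ^ k) l sequentially \<longleftrightarrow> ?thesis"
    by (intro uniform_limit_cong') auto
  with l show ?thesis by blast
qed (auto simp: uniform_limit_iff)

lemma holomorphic_poch5:
  assumes "a > 0"
  shows "poch5 a holomorphic_on ball 0 1"
proof (rule holomorphic_uniform_sequence[where f = "\<lambda>n q. \<Prod>k<n. 1 - q ^ a * (q ^ 5) ^ k"])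
  fix x :: complex assume x: "x \<in> ball 0 1"
  define d where "d = (1 - norm x) / 2"
  have d: "d > 0" "norm x + d < 1" using x by (auto simp: d_def field_simps)
  have sub: "cball x d \<subseteq> cball 0 (norm x + d)"
    by (auto simp: dist_norm) (metis add.commute add_left_mono norm_minus_commute norm_triangle_sub order_trans)
  have "uniform_limit (cball x d) (\<lambda>n q. \<Prod>k<n. 1 - q ^ a * (q ^ 5) ^ k) (poch5 a) sequentially"
    by (rule uniform_limit_on_subset[OF uniform_limit_poch5[OF d(2) assms] sub])
  moreover have "cball x d \<subseteq> ball 0 1" using sub d by force
  ultimately show "\<exists>d>0. cball x d \<subseteq> ball 0 1 \<and> uniform_limit (cball x d) (\<lambda>n q. \<Prod>k<n. 1 - q ^ a * (q ^ 5) ^ k) (poch5 a) sequentially"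
    using d by blast
qed (auto intro!: holomorphic_intros)

text \<open>The reciprocals of \<open>alpha\<close> and \<open>beta\<close> are the product sides of
  the two Rogers-Ramanujan identities.\<close>

definition alpha :: "complex \<Rightarrow> complex" where "alpha q = poch5 1 q * poch5 4 q"
definition beta :: "complex \<Rightarrow> complex" where "beta q = poch5 2 q * poch5 3 q"

lemma rogers_ramanujan_R_eq: "rogers_ramanujan_R q = alpha q / beta q"
  by (simp add: rogers_ramanujan_R_def alpha_def beta_def poch5_def)

lemma alpha_nonzero: "norm q < 1 \<Longrightarrow> alpha q \<noteq> 0"
  and beta_nonzero: "norm q < 1 \<Longrightarrow> beta q \<noteq> 0"
  by (simp_all add: alpha_def beta_def poch5_nonzero)

lemma holomorphic_alpha: "alpha holomorphic_on ball 0 1"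
  and holomorphic_beta: "beta holomorphic_on ball 0 1"
  unfolding alpha_def beta_def by (intro holomorphic_intros holomorphic_poch5; simp)+

lemma theta1_eq: "theta1 q = alpha q * poch5 5 q" and theta2_eq: "theta2 q = beta q * poch5 5 q"
  by (simp_all add: theta1_def theta2_def alpha_def beta_def)

lemma qpoch_inf_split5:
  assumes "norm q < 1"
  shows "qpoch_inf a q = qpoch_inf a (q ^ 5) * qpoch_inf (a * q) (q ^ 5) * qpoch_inf (a * q ^ 2) (q ^ 5)
           * qpoch_inf (a * q ^ 3) (q ^ 5) * qpoch_inf (a * q ^ 4) (q ^ 5)"
proof -
  have q5: "norm (q ^ 5) < 1" by (rule norm_power_less_1[OF assms]) simp
  let ?p = "\<lambda>b n. \<Prod>k<n. 1 - b * (q ^ 5) ^ k"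
  have "(\<Prod>k<5*n. 1 - a * q ^ k) = ?p a n * ?p (a * q) n * ?p (a * q ^ 2) n * ?p (a * q ^ 3) n * ?p (a * q ^ 4) n" for n
  proof (induction n)
    case (Suc n)
    have s: "5 * Suc n = Suc (Suc (Suc (Suc (Suc (5 * n)))))" by simp
    have e: "q ^ Suc (5 * n) = q * (q ^ 5) ^ n" "q ^ Suc (Suc (5 * n)) = q ^ 2 * (q ^ 5) ^ n"
       "q ^ Suc (Suc (Suc (5 * n))) = q ^ 3 * (q ^ 5) ^ n" "q ^ Suc (Suc (Suc (Suc (5 * n)))) = q ^ 4 * (q ^ 5) ^ n"
      "q ^ (5 * n) = (q ^ 5) ^ n"
      by (simp_all only: power_Suc power_mult power2_eq_square power3_eq_cube power4_eq_xxxx mult.assoc)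
    show ?case unfolding s prod.lessThan_Suc Suc.IH e by (simp only: mult_ac)
  qed simp
  moreover have "(\<lambda>n. ?p a n * ?p (a * q) n * ?p (a * q ^ 2) n * ?p (a * q ^ 3) n * ?p (a * q ^ 4) n) \<longlonglongrightarrow>
     qpoch_inf a (q ^ 5) * qpoch_inf (a * q) (q ^ 5) * qpoch_inf (a * q ^ 2) (q ^ 5)
           * qpoch_inf (a * q ^ 3) (q ^ 5) * qpoch_inf (a * q ^ 4) (q ^ 5)"
    by (intro tendsto_mult qpoch_inf_LIMSEQ q5)
  moreover have "(\<lambda>n. \<Prod>k<5*n. 1 - a * q ^ k) \<longlonglongrightarrow> qpoch_inf a q"
    by (rule filterlim_compose[OF qpoch_inf_LIMSEQ[OF assms]], rule filterlim_subseq) (auto simp: strict_mono_def)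
  ultimately show ?thesis using LIMSEQ_unique by force
qed

text \<open>With p = q^5 the left side is (p;p)_inf, whose factors are sorted by exponent modulo
  5.\<close>

lemma poch5_5_eq:
  assumes "norm q < 1"
  shows "poch5 5 q = alpha (q ^ 5) * beta (q ^ 5) * poch5 5 (q ^ 5)"
proof -
  define p where "p = q ^ 5"
  have "norm p < 1" unfolding p_def by (rule norm_power_less_1[OF assms]) simp
  from qpoch_inf_split5[OF this, of p]
  have "qpoch_inf p p = poch5 1 p * poch5 2 p * poch5 3 p * poch5 4 p * poch5 5 p"
    by (simp add: poch5_def power2_eq_square power3_eq_cube power_numeral_reduce)
  thus ?thesis unfolding alpha_def beta_def p_def[symmetric] by (simp add: poch5_def[of 5 q] p_def mult_ac)
qed

text \<open>The quintic theta identity after cancelling (q^25;q^25)_inf squared;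
  \<open>poch5_5_eq\<close> makes this factor appear on the left.\<close>

lemma alpha_beta_quintic:
  assumes "norm q < 1"
  shows "alpha q * beta q * alpha (q ^ 5) ^ 2 * beta (q ^ 5) ^ 2 =
         beta (q ^ 5) ^ 2 - q * alpha (q ^ 5) * beta (q ^ 5) - q ^ 2 * alpha (q ^ 5) ^ 2"
proof -
  define p where "p = poch5 5 (q ^ 5)"
  have q5: "norm (q ^ 5) < 1" by (rule norm_power_less_1[OF assms]) simp
  have p: "p \<noteq> 0" unfolding p_def by (rule poch5_nonzero[OF q5]) simp
  have "p ^ 2 * (alpha q * beta q * alpha (q ^ 5) ^ 2 * beta (q ^ 5) ^ 2) =
         p ^ 2 * (beta (q ^ 5) ^ 2 - q * alpha (q ^ 5) * beta (q ^ 5) - q ^ 2 * alpha (q ^ 5) ^ 2)"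
    using theta1_theta2_quintic[OF assms]
    unfolding theta1_eq theta2_eq poch5_5_eq[OF assms] p_def[symmetric] by algebra
  with p show ?thesis by simp
qed

subsection \<open>Multiplying over the fifth roots of unity\<close>

lemma fifth_roots_prod:
  fixes w x y :: complex
  assumes "1 + w + w ^ 2 + w ^ 3 + w ^ 4 = 0"
  shows "(x - y) * (x - w * y) * (x - w ^ 2 * y) * (x - w ^ 3 * y) * (x - w ^ 4 * y) = x ^ 5 - y ^ 5"
  using assms by algebra

text \<open>The quadratic form splits over the golden ratio a and its conjugate b, where a + b = 1
  and a b = -1; each linear factor then multiplies up to a difference of fifth powers. The 11 is the
  Lucas number a^5 + b^5.\<close>

lemma fifth_roots_prod_quadratic:
  fixes w x y :: complex
  assumes w: "1 + w + w ^ 2 + w ^ 3 + w ^ 4 = 0"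
  defines "f \<equiv> \<lambda>v. x ^ 2 - x * (v * y) - (v * y) ^ 2"
  shows "f 1 * f w * f (w ^ 2) * f (w ^ 3) * f (w ^ 4) = x ^ 10 - 11 * x ^ 5 * y ^ 5 - y ^ 10"
proof -
  define s where "s = complex_of_real (sqrt 5)"
  have s: "s ^ 2 = 5" by (simp add: s_def flip: of_real_power)
  define a b where "a = (1 + s) / 2" and "b = (1 - s) / 2"
  have ab: "a + b = 1" "a * b = -1" using s by (simp_all add: a_def b_def field_simps power2_eq_square)
  have f: "f v = (x - v * (a * y)) * (x - v * (b * y))" for v
    unfolding f_def using ab by algebra
  have "f 1 * f w * f (w ^ 2) * f (w ^ 3) * f (w ^ 4) = 
    ((x - a * y) * (x - w * (a * y)) * (x - w ^ 2 * (a * y)) * (x - w ^ 3 * (a * y)) * (x - w ^ 4 * (a * y))) *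
    ((x - b * y) * (x - w * (b * y)) * (x - w ^ 2 * (b * y)) * (x - w ^ 3 * (b * y)) * (x - w ^ 4 * (b * y)))"
    unfolding f by (simp add: mult_ac)
  also have "\<dots> = (x ^ 5 - (a * y) ^ 5) * (x ^ 5 - (b * y) ^ 5)"
    by (simp only: fifth_roots_prod[OF w])
  also have "\<dots> = x ^ 10 - (a ^ 5 + b ^ 5) * x ^ 5 * y ^ 5 + (a * b) ^ 5 * y ^ 10"
    by algebra
  also have "a ^ 5 + b ^ 5 = 11" using ab by algebra
  finally show ?thesis by (simp add: ab)
qed

lemma qpoch_inf_fifth_roots:
  assumes w: "1 + w + w ^ 2 + w ^ 3 + w ^ 4 = 0" and q: "norm q < 1"
  shows "qpoch_inf x q * qpoch_inf (w * x) q * qpoch_inf (w ^ 2 * x) q * qpoch_inf (w ^ 3 * x) q * qpoch_inf (w ^ 4 * x) q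
    = qpoch_inf (x ^ 5) (q ^ 5)"
proof -
  have q5: "norm (q ^ 5) < 1" by (rule norm_power_less_1[OF q]) simp
  let ?p = "\<lambda>b n. \<Prod>k<n. 1 - b * q ^ k"
  have "(\<lambda>n. ?p x n * ?p (w * x) n * ?p (w ^ 2 * x) n * ?p (w ^ 3 * x) n * ?p (w ^ 4 * x) n) \<longlonglongrightarrow>
     qpoch_inf x q * qpoch_inf (w * x) q * qpoch_inf (w ^ 2 * x) q * qpoch_inf (w ^ 3 * x) q * qpoch_inf (w ^ 4 * x) q"
    by (intro tendsto_mult qpoch_inf_LIMSEQ q)
  moreover have "?p x n * ?p (w * x) n * ?p (w ^ 2 * x) n * ?p (w ^ 3 * x) n * ?p (w ^ 4 * x) n
    = (\<Prod>k<n. 1 - x ^ 5 * (q ^ 5) ^ k)" for n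
  proof -
    have "(1 - x * q ^ k) * (1 - w * x * q ^ k) * (1 - w ^ 2 * x * q ^ k) * (1 - w ^ 3 * x * q ^ k) * (1 - w ^ 4 * x * q ^ k)
       = 1 - x ^ 5 * (q ^ 5) ^ k" for k
    proof -
      have "(x * q ^ k) ^ 5 = x ^ 5 * (q ^ 5) ^ k"
        by (simp add: power_mult_distrib mult.commute flip: power_mult)
      thus ?thesis using fifth_roots_prod[OF w, of 1 "x * q ^ k"] by (simp only: mult.assoc power_one)
    qed
    thus ?thesis by (simp flip: prod.distrib)
  qed
  ultimately show ?thesis
    using LIMSEQ_unique[OF _ qpoch_inf_LIMSEQ[OF q5, of "x ^ 5"]] by simp
qed

lemma fifth_root_exists:
  obtains w :: complex where "w \<noteq> 1" "w ^ 5 = 1"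
proof
  show "cis (2 * pi / 5) ^ 5 = 1" using Complex.DeMoivre[of "2 * pi / 5" 5] by simp
  have "sin (2 * pi / 5) > 0" by (intro sin_gt_zero) auto
  thus "cis (2 * pi / 5) \<noteq> 1" by (auto simp: complex_eq_iff)
qed

lemma fifth_root_sum:
  fixes w :: complex
  assumes "w \<noteq> 1" "w ^ 5 = 1"
  shows "1 + w + w ^ 2 + w ^ 3 + w ^ 4 = 0"
proof -
  have "(w - 1) * (1 + w + w ^ 2 + w ^ 3 + w ^ 4) = w ^ 5 - 1" by algebra
  thus ?thesis using assms by simp
qed

text \<open>Apply \<open>alpha_beta_quintic\<close> at the five points v z with v^5 = 1 and z^5 = q,
  and multiply. On the right \<open>alpha\<close> and \<open>beta\<close> are always taken at q,
  leaving the norm of a quadratic form; on the left the values at the five points multiply to alpha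
  q * beta q, next to the factor (alpha q * beta q)^10.\<close>

lemma alpha_beta_degree_10:
  assumes "norm q < 1"
  shows "beta q ^ 10 - 11 * q * alpha q ^ 5 * beta q ^ 5 - q ^ 2 * alpha q ^ 10 = (alpha q * beta q) ^ 11"
proof -
  obtain w :: complex where w: "w \<noteq> 1" "w ^ 5 = 1" by (rule fifth_root_exists)
  have nw: "norm w = 1" using w(2) by (metis norm_one norm_power power_eq_1_iff zero_neq_numeral norm_ge_zero)
  define z where "z = root 5 (norm q) * cis (Arg q / 5)"
  have z5: "z ^ 5 = q"
  proof -
    have "cis (Arg q / 5) ^ 5 = cis (Arg q)" using Complex.DeMoivre[of "Arg q / 5" 5] by simp
    moreover have "complex_of_real (root 5 (norm q)) ^ 5 = of_real (norm q)"
      by (simp flip: of_real_power)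
    ultimately show ?thesis
      unfolding z_def power_mult_distrib using rcis_cmod_Arg[of q] by (simp add: rcis_def)
  qed
  have z: "norm z < 1"
    using assms unfolding z5[symmetric] norm_power by (simp add: power_less_one_iff)
  define A B where "A = alpha q" and "B = beta q"
  define g where "g v = alpha (v * z) * beta (v * z)" for v
  have nv: "norm (w ^ i * z) < 1" for i using z by (simp add: norm_mult norm_power nw)
  have v5: "(w ^ i * z) ^ 5 = q" for i
  proof -
    have "(w ^ i) ^ 5 = (w ^ 5) ^ i" by (simp add: mult.commute flip: power_mult)
    thus ?thesis using w z5 by (simp add: power_mult_distrib)
  qed
  have step: "g (w ^ i) * (A * B) ^ 2 = B ^ 2 - B * (w ^ i * (z * A)) - (w ^ i * (z * A)) ^ 2" for i
  proof -
    define v where "v = w ^ i"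
    show ?thesis
      using alpha_beta_quintic[OF nv[of i], unfolded v5]
      unfolding A_def[symmetric] B_def[symmetric] g_def v_def[symmetric] by algebra
  qed
  note sum = fifth_root_sum[OF w]
  have "(g 1 * g w * g (w ^ 2) * g (w ^ 3) * g (w ^ 4)) * (A * B) ^ 10 = 
     (g (w ^ 0) * (A * B) ^ 2) * (g (w ^ 1) * (A * B) ^ 2) * (g (w ^ 2) * (A * B) ^ 2) * (g (w ^ 3) * (A * B) ^ 2) * (g (w ^ 4) * (A * B) ^ 2)"
    by (simp only: power_0 power_one_right) algebra
  also have "\<dots> = B ^ 10 - 11 * B ^ 5 * (z * A) ^ 5 - (z * A) ^ 10"
    unfolding step using fifth_roots_prod_quadratic[OF sum, of B "z * A"] by simp
  also have "\<dots> = B ^ 10 - 11 * q * A ^ 5 * B ^ 5 - q ^ 2 * A ^ 10"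
    unfolding z5[symmetric] by algebra
  also have "g 1 * g w * g (w ^ 2) * g (w ^ 3) * g (w ^ 4) = A * B"
  proof -
    \<comment> \<open>As w^a is again a primitive fifth root of unity, the five products of base q
      combine to base q^5, while the argument z^a becomes q^a.\<close>
    have P: "poch5 a z * poch5 a (w * z) * poch5 a (w ^ 2 * z) * poch5 a (w ^ 3 * z) * poch5 a (w ^ 4 * z) = poch5 a q"
      if "w ^ a \<noteq> 1" for a
    proof -
      define u where "u = w ^ a"
      have "u ^ 5 = 1" unfolding u_def using w(2) by (metis mult.commute power_mult power_one)
      from fifth_root_sum[OF _ this] that have u: "1 + u + u ^ 2 + u ^ 3 + u ^ 4 = 0" by (simp add: u_def)
      have e: "poch5 a (w ^ i * z) = qpoch_inf (u ^ i * z ^ a) q" for i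
        unfolding poch5_def v5 by (simp add: u_def power_mult_distrib mult.commute flip: power_mult)
      have zq: "(z ^ a) ^ 5 = q ^ a" unfolding z5[symmetric] by (simp add: mult.commute flip: power_mult)
      show ?thesis using qpoch_inf_fifth_roots[OF u assms, of "z ^ a"] e[of 0] e[of 1] e[of 2] e[of 3] e[of 4]
        unfolding zq poch5_def[of a q] by simp
    qed
    have "w ^ a \<noteq> 1" if a: "a \<in> {1, 2, 3, 4}" for a
    proof
      assume "w ^ a = 1"
      consider "a = 1" | "a = 2" | "a = 3" | "a = 4" using a by auto
      hence "w = 1"
      proof cases
        case 2
        hence "w ^ 2 = 1" using \<open>w ^ a = 1\<close> by simp
        thus ?thesis using w(2) by algebra
      next
        case 3
        hence "w ^ 3 = 1" using \<open>w ^ a = 1\<close> by simp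
        thus ?thesis using w(2) by algebra
      next
        case 4
        hence "w ^ 4 = 1" using \<open>w ^ a = 1\<close> by simp
        thus ?thesis using w(2) by algebra
      qed (use \<open>w ^ a = 1\<close> in simp)
      thus False using w by simp
    qed
    note P' = P[OF this]
    have "g 1 * g w * g (w ^ 2) * g (w ^ 3) * g (w ^ 4) = 
      (poch5 1 z * poch5 1 (w * z) * poch5 1 (w ^ 2 * z) * poch5 1 (w ^ 3 * z) * poch5 1 (w ^ 4 * z)) *
      (poch5 4 z * poch5 4 (w * z) * poch5 4 (w ^ 2 * z) * poch5 4 (w ^ 3 * z) * poch5 4 (w ^ 4 * z)) *
      ((poch5 2 z * poch5 2 (w * z) * poch5 2 (w ^ 2 * z) * poch5 2 (w ^ 3 * z) * poch5 2 (w ^ 4 * z)) *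
      (poch5 3 z * poch5 3 (w * z) * poch5 3 (w ^ 2 * z) * poch5 3 (w ^ 3 * z) * poch5 3 (w ^ 4 * z)))"
      unfolding g_def alpha_def beta_def mult_1 by (simp only: mult_ac)
    also have "\<dots> = A * B" unfolding A_def B_def alpha_def beta_def using P' by simp
    finally show ?thesis .
  qed
  finally show ?thesis unfolding A_def B_def by algebra
qed

subsection \<open>The quintic modular equation\<close>

text \<open>With r(q) = q^(1/5) R(q) and w = r(q^5) = q R(q^5), Ramanujan's modular equation of
  degree 5 reads r(q)^5 = w N(w) / D(w); N and D are \<open>ratio_num\<close> and
  \<open>ratio_den\<close>.\<close>

definition ratio_num :: "complex \<Rightarrow> complex" where "ratio_num w = 1 - 2 * w + 4 * w ^ 2 - 3 * w ^ 3 + w ^ 4"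
definition ratio_den :: "complex \<Rightarrow> complex" where "ratio_den w = 1 + 3 * w + 4 * w ^ 2 + 2 * w ^ 3 + w ^ 4"

text \<open>For V = w N / D the second identity says 1 - 11 V - V^2 = (1 - w - w^2)^5 / D^2.
  Together they let the quadratic equation for V factor over the polynomials in w.\<close>

lemma ratio_num_den:
  "ratio_num w * ratio_den w * (1 - w - w ^ 2) = 1 - 11 * w ^ 5 - w ^ 10"
  "ratio_den w ^ 2 - w ^ 2 * ratio_num w ^ 2 - 11 * w * ratio_num w * ratio_den w = (1 - w - w ^ 2) ^ 5"
  unfolding ratio_num_def ratio_den_def by algebra+

definition rr_v :: "complex \<Rightarrow> complex" where "rr_v q = q * (alpha q / beta q) ^ 5"
definition rr_w :: "complex \<Rightarrow> complex" where "rr_w q = q * (alpha (q ^ 5) / beta (q ^ 5))"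

text \<open>This is \<open>alpha_beta_degree_10\<close> divided by beta^10; \<open>rr_w_poly\<close>
  below is \<open>alpha_beta_quintic\<close> divided by beta(q^5)^2.\<close>

lemma rr_v_poly:
  assumes "norm q < 1"
  shows "1 - 11 * rr_v q - rr_v q ^ 2 = alpha q ^ 11 * beta q"
proof -
  note nz = beta_nonzero[OF assms]
  define t where "t = alpha q / beta q"
  have a: "alpha q = t * beta q" using nz by (simp add: t_def)
  have v: "rr_v q = q * t ^ 5" by (simp add: rr_v_def t_def)
  have "beta q ^ 10 * (1 - 11 * rr_v q - rr_v q ^ 2) = beta q ^ 10 * (alpha q ^ 11 * beta q)"
    using alpha_beta_degree_10[OF assms] unfolding v a by algebra
  thus ?thesis using nz by simp
qed

lemma rr_w_poly:
  assumes "norm q < 1"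
  shows "1 - rr_w q - rr_w q ^ 2 = alpha q * beta q * alpha (q ^ 5) ^ 2"
proof -
  have q5: "norm (q ^ 5) < 1" by (rule norm_power_less_1[OF assms]) simp
  note nz = beta_nonzero[OF q5]
  define t where "t = alpha (q ^ 5) / beta (q ^ 5)"
  have a: "alpha (q ^ 5) = t * beta (q ^ 5)" using nz by (simp add: t_def)
  have w: "rr_w q = q * t" by (simp add: rr_w_def t_def)
  have "beta (q ^ 5) ^ 2 * (1 - rr_w q - rr_w q ^ 2) = beta (q ^ 5) ^ 2 * (alpha q * beta q * alpha (q ^ 5) ^ 2)"
    using alpha_beta_quintic[OF assms] unfolding w a by algebra
  thus ?thesis using nz by simp
qed

lemma rr_w_power_5: "rr_w q ^ 5 = rr_v (q ^ 5)"
  by (simp add: rr_w_def rr_v_def power_mult_distrib power_divide)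

lemma rr_w_poly_5:
  assumes "norm q < 1"
  shows "1 - 11 * rr_w q ^ 5 - rr_w q ^ 10 = alpha (q ^ 5) ^ 11 * beta (q ^ 5)"
proof -
  have "rr_w q ^ 10 = (rr_w q ^ 5) ^ 2" by (simp flip: power_mult)
  thus ?thesis using rr_v_poly[of "q ^ 5"] norm_power_less_1[OF assms, of 5] by (simp add: rr_w_power_5)
qed

text \<open>The three product formulas eliminate all infinite products, leaving (1 - 11 V - V^2) w
  (1 - 11 w^5 - w^10) = V L^6 with L = 1 - w - w^2. Cancelling L and rewriting L^5 by
  \<open>ratio_num_den\<close> makes the terms with 11 cancel, and the rest factors.\<close>

lemma rr_quintic_factor:
  assumes "norm q < 1"
  defines "V \<equiv> rr_v q" and "w \<equiv> rr_w q"
  shows "(w * ratio_num w - V * ratio_den w) * (ratio_den w + V * w * ratio_num w) = 0"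
proof -
  have q5: "norm (q ^ 5) < 1" by (rule norm_power_less_1[OF assms(1)]) simp
  note nz = alpha_nonzero[OF assms(1)] beta_nonzero[OF assms(1)] alpha_nonzero[OF q5] beta_nonzero[OF q5]
  define L where "L = 1 - w - w ^ 2"
  have L: "L = alpha q * beta q * alpha (q ^ 5) ^ 2" unfolding L_def w_def by (rule rr_w_poly[OF assms(1)])
  have L0: "L \<noteq> 0" unfolding L using nz by simp
  have "(1 - 11 * V - V ^ 2) * w * (1 - 11 * w ^ 5 - w ^ 10) = V * L ^ 6"
  proof -
    have "(1 - 11 * V - V ^ 2) * w * (1 - 11 * w ^ 5 - w ^ 10) = alpha q ^ 11 * beta q * w * (alpha (q ^ 5) ^ 11 * beta (q ^ 5))"
      unfolding V_def w_def rr_v_poly[OF assms(1)] rr_w_poly_5[OF assms(1)] ..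
    also have "\<dots> = q * alpha q ^ 11 * beta q * alpha (q ^ 5) ^ 12"
      using nz by (simp add: w_def rr_w_def field_simps power_numeral_reduce)
    also have "\<dots> = V * L ^ 6"
      unfolding V_def rr_v_def L using nz by (simp add: field_simps power_numeral_reduce)
    finally show ?thesis .
  qed
  hence "L * ((1 - 11 * V - V ^ 2) * w * (ratio_num w * ratio_den w)) = L * (V * L ^ 5)"
    unfolding ratio_num_den(1)[symmetric] L_def[symmetric] by algebra
  hence "(1 - 11 * V - V ^ 2) * w * (ratio_num w * ratio_den w) = V * L ^ 5"
    using L0 by simp
  thus ?thesis unfolding L_def ratio_num_den(2)[symmetric] by algebra
qed

lemma holomorphic_alpha_beta_power_5:
  "(\<lambda>q. alpha (q ^ 5)) holomorphic_on ball 0 1" "(\<lambda>q. beta (q ^ 5)) holomorphic_on ball 0 1"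
proof -
  have im: "(\<lambda>q. q ^ 5) ` ball 0 1 \<subseteq> ball (0 :: complex) 1" using norm_power_less_1[of _ 5] by auto
  have h: "(\<lambda>q :: complex. q ^ 5) holomorphic_on ball 0 1" by (intro holomorphic_intros)
  show "(\<lambda>q. alpha (q ^ 5)) holomorphic_on ball 0 1" "(\<lambda>q. beta (q ^ 5)) holomorphic_on ball 0 1"
    using holomorphic_on_compose_gen[OF h holomorphic_alpha im] holomorphic_on_compose_gen[OF h holomorphic_beta im]
    by (simp_all add: o_def)
qed

text \<open>The second factor of \<open>rr_quintic_factor\<close> equals 1 at q = 0 and stays
  nonzero nearby, so the first factor vanishes near 0, hence on the whole disc by the identity
  theorem.\<close>

lemma rr_quintic:
  assumes "norm q < 1"
  shows "rr_v q * ratio_den (rr_w q) = rr_w q * ratio_num (rr_w q)"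
proof -
  have nz: "beta q \<noteq> 0" "beta (q ^ 5) \<noteq> 0" if "q \<in> ball 0 1" for q
    using that beta_nonzero[of q] beta_nonzero[of "q ^ 5"] norm_power_less_1[of q 5] by auto
  have V: "rr_v holomorphic_on ball 0 1" and W: "rr_w holomorphic_on ball 0 1"
    unfolding rr_v_def rr_w_def using nz
    by (auto intro!: holomorphic_intros holomorphic_alpha holomorphic_beta holomorphic_alpha_beta_power_5)
  define f where "f q = ratio_den (rr_w q) + rr_v q * rr_w q * ratio_num (rr_w q)" for q
  have f: "f holomorphic_on ball 0 1"
    unfolding f_def ratio_num_def ratio_den_def by (intro holomorphic_intros V W)
  have "f 0 \<noteq> 0" by (simp add: f_def rr_w_def rr_v_def ratio_den_def)
  moreover have "isCont f 0"
    using holomorphic_on_imp_continuous_on[OF f] by (simp add: continuous_on_eq_continuous_at)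
  ultimately obtain e where e: "e > 0" "\<And>y. dist 0 y < e \<Longrightarrow> f y \<noteq> 0"
    using continuous_at_avoid[of 0 f 0] by (auto simp: dist_commute)
  show ?thesis
  proof (rule analytic_continuation_open[of "ball 0 (min e 1)" "ball 0 1"
        "\<lambda>q. rr_v q * ratio_den (rr_w q)" "\<lambda>q. rr_w q * ratio_num (rr_w q)"])
    show "(\<lambda>q. rr_v q * ratio_den (rr_w q)) holomorphic_on ball 0 1" "(\<lambda>q. rr_w q * ratio_num (rr_w q)) holomorphic_on ball 0 1"
      unfolding ratio_num_def ratio_den_def by (intro holomorphic_intros V W)+
    show "rr_v z * ratio_den (rr_w z) = rr_w z * ratio_num (rr_w z)" if "z \<in> ball 0 (min e 1)" for z
      using rr_quintic_factor[of z] e(2)[of z] that by (auto simp: f_def)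
  qed (use e assms in auto)
qed

text \<open>Dividing the modular equation by q gives the quotient as N/D; expanding by N (1 - w -
  w^2) turns the denominator into 1 - 11 w^5 - w^10, which depends on q^5 alone. The point q = 0 is
  checked directly.\<close>

lemma rr_quotient_eq:
  assumes "norm q < 1"
  defines "w \<equiv> rr_w q"
  shows "rogers_ramanujan_R q ^ 5 / rogers_ramanujan_R (q ^ 5) =
    ratio_num w ^ 2 * (1 - w - w ^ 2) / (alpha (q ^ 5) ^ 11 * beta (q ^ 5))"
proof (cases "q = 0")
  case True
  have "alpha 0 = 1" "beta 0 = 1" by (simp_all add: alpha_def beta_def poch5_def qpoch_inf_def)
  thus ?thesis using True by (simp add: rogers_ramanujan_R_eq w_def rr_w_def ratio_num_def)
next
  case False
  have q5: "norm (q ^ 5) < 1" by (rule norm_power_less_1[OF assms(1)]) simp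
  note nz = alpha_nonzero[OF assms(1)] beta_nonzero[OF assms(1)] alpha_nonzero[OF q5] beta_nonzero[OF q5]
  define x y where "x = alpha q / beta q" and "y = alpha (q ^ 5) / beta (q ^ 5)"
  have y: "y \<noteq> 0" using nz by (simp add: y_def)
  define P where "P = alpha (q ^ 5) ^ 11 * beta (q ^ 5)"
  have P0: "P \<noteq> 0" using nz by (simp add: P_def)
  have P: "P = ratio_num w * ratio_den w * (1 - w - w ^ 2)"
    unfolding ratio_num_den(1) w_def P_def rr_w_poly_5[OF assms(1)] ..
  have "q * (x ^ 5 * ratio_den w) = q * (y * ratio_num w)"
    using rr_quintic[OF assms(1)] by (simp add: rr_v_def x_def y_def w_def rr_w_def mult_ac)
  hence "x ^ 5 * ratio_den w = y * ratio_num w" using False by simp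
  moreover define L where "L = 1 - w - w ^ 2"
  moreover have nz': "ratio_num w \<noteq> 0" "ratio_den w \<noteq> 0" "L \<noteq> 0" using P P0 by (auto simp: L_def)
  ultimately have "x ^ 5 / y = ratio_num w / ratio_den w" using y by (simp add: field_simps)
  also have "\<dots> = ratio_num w ^ 2 * (1 - w - w ^ 2) / P"
    unfolding P L_def[symmetric] using nz' by (simp add: power2_eq_square)
  finally show ?thesis unfolding rogers_ramanujan_R_eq x_def y_def P_def .
qed


subsection \<open>Power series with natural number coefficients\<close>

definition nat_coeffs :: "complex fps \<Rightarrow> bool" where
  "nat_coeffs F \<longleftrightarrow> (\<forall>n. fps_nth F n \<in> \<nat>)"

lemma sum_in_Nats:
  fixes f :: "'a \<Rightarrow> complex"
  shows "(\<And>x. x \<in> A \<Longrightarrow> f x \<in> \<nat>) \<Longrightarrow> sum f A \<in> \<nat>"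
  by (induction A rule: infinite_finite_induct) auto

lemma nat_coeffs_add: "nat_coeffs F \<Longrightarrow> nat_coeffs G \<Longrightarrow> nat_coeffs (F + G)"
  by (simp add: nat_coeffs_def)

lemma nat_coeffs_mult: "nat_coeffs F \<Longrightarrow> nat_coeffs G \<Longrightarrow> nat_coeffs (F * G)"
  by (auto simp: nat_coeffs_def fps_mult_nth intro!: sum_in_Nats Nats_mult)

lemma nat_coeffs_1: "nat_coeffs 1" and nat_coeffs_X: "nat_coeffs fps_X"
  and nat_coeffs_numeral: "nat_coeffs (numeral k)"
  by (auto simp: nat_coeffs_def fps_X_def fps_numeral_nth)

lemma nat_coeffs_power: "nat_coeffs F \<Longrightarrow> nat_coeffs (F ^ n)"
  by (induction n) (auto intro: nat_coeffs_1 nat_coeffs_mult)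

lemmas nat_coeffs_intros = nat_coeffs_add nat_coeffs_mult nat_coeffs_1 nat_coeffs_X nat_coeffs_numeral nat_coeffs_power

lemma nat_coeffs_minus_1:
  assumes "nat_coeffs F" "fps_nth F 0 = 1"
  shows "nat_coeffs (F - 1)"
  unfolding nat_coeffs_def
proof
  fix n show "fps_nth (F - 1) n \<in> \<nat>"
    using assms by (cases n) (auto simp: nat_coeffs_def)
qed

definition fps_geom :: "nat \<Rightarrow> complex fps" where
  "fps_geom k = Abs_fps (\<lambda>n. if k dvd n then 1 else 0)"

lemma nat_coeffs_geom: "nat_coeffs (fps_geom k)"
  by (auto simp: nat_coeffs_def fps_geom_def)

lemma fps_geom_mult:
  assumes "k > 0"
  shows "(1 - fps_X ^ k) * fps_geom k = 1"
proof (rule fps_ext)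
  fix n
  show "fps_nth ((1 - fps_X ^ k) * fps_geom k) n = fps_nth 1 n"
  proof (cases "n < k")
    case True
    thus ?thesis using nat_dvd_not_less[of n k] by (cases "n = 0") (auto simp: left_diff_distrib fps_X_power_mult_nth fps_geom_def)
  next
    case False
    thus ?thesis using assms by (auto simp: left_diff_distrib fps_X_power_mult_nth fps_geom_def dvd_minus_self)
  qed
qed

text \<open>The generating function of partitions with parts in \<open>K\<close>, and its
  reciprocal, which counts partitions into distinct parts from \<open>K\<close> with sign according
  to the number of parts.\<close>

definition part_fps :: "nat set \<Rightarrow> complex fps" where "part_fps K = (\<Prod>k\<in>K. fps_geom k)"
definition dist_fps :: "nat set \<Rightarrow> complex fps" where "dist_fps K = (\<Prod>k\<in>K. 1 - fps_X ^ k)"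

lemma dist_part_fps:
  assumes "0 \<notin> K"
  shows "dist_fps K * part_fps K = 1"
  unfolding dist_fps_def part_fps_def prod.distrib[symmetric]
  by (rule prod.neutral) (use assms in \<open>auto intro!: fps_geom_mult gr0I\<close>)

lemma nat_coeffs_part_fps: "nat_coeffs (part_fps K)"
  unfolding part_fps_def by (induction K rule: infinite_finite_induct) (auto intro: nat_coeffs_intros nat_coeffs_geom)

lemma part_fps_nth_0: "fps_nth (part_fps K) 0 = 1"
  unfolding part_fps_def by (induction K rule: infinite_finite_induct) (auto simp: fps_geom_def)

lemma dist_fps_nth_0: "0 \<notin> K \<Longrightarrow> fps_nth (dist_fps K) 0 = 1"
  using arg_cong[OF dist_part_fps[of K], of "\<lambda>F. fps_nth F 0"] by (simp add: part_fps_nth_0)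

text \<open>Jointly the two claims bound the coefficients of \<open>dist_fps K\<close> in absolute
  value by those of \<open>part_fps K\<close>. They need a simultaneous induction: with G = 1 + Y +
  Y^2 G, the term linear in Y carries the opposite sign combination.\<close>

lemma nat_coeffs_part_pm_dist:
  assumes "finite K" "0 \<notin> K"
  shows "nat_coeffs (part_fps K + dist_fps K) \<and> nat_coeffs (part_fps K - dist_fps K)"
  using assms
proof (induction K rule: finite_induct)
  case empty
  have "nat_coeffs (1 + 1)" "nat_coeffs 0"
    by (intro nat_coeffs_intros) (simp add: nat_coeffs_def)
  thus ?case by (simp add: part_fps_def dist_fps_def)
next
  case (insert k K)
  define P M G Y where "P = part_fps K" and "M = dist_fps K" and "G = fps_geom k" and "Y = (fps_X :: complex fps) ^ k"
  have e: "part_fps (insert k K) = G * P" "dist_fps (insert k K) = (1 - Y) * M"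
    using insert by (simp_all add: part_fps_def dist_fps_def P_def M_def G_def Y_def)
  have g: "(1 - Y) * G = 1" unfolding Y_def G_def by (rule fps_geom_mult) (use insert in auto)
  have 1: "G * P + (1 - Y) * M = (P + M) + Y * (P - M) + Y ^ 2 * (G * P)" using g by algebra
  have 2: "G * P - (1 - Y) * M = (P - M) + Y * (P + M) + Y ^ 2 * (G * P)" using g by algebra
  have ih: "nat_coeffs (P + M)" "nat_coeffs (P - M)" using insert by (auto simp: P_def M_def)
  have c: "nat_coeffs P" "nat_coeffs G" "nat_coeffs Y"
    unfolding P_def G_def Y_def by (intro nat_coeffs_part_fps nat_coeffs_geom nat_coeffs_intros)+
  show ?case unfolding e 1 2 by (intro conjI nat_coeffs_intros ih c)
qed

text \<open>Every partition of n > 0 arises from one of n - k by adding some part k, so there are at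
  most as many of them as such pairs. The final 1 compensates for the empty partition at n =
  0.\<close>

lemma nat_coeffs_part_sum:
  assumes "finite K" "0 \<notin> K"
  shows "nat_coeffs (part_fps K * (\<Sum>k\<in>K. fps_X ^ k) - part_fps K + 1)"
  using assms
proof (induction K rule: finite_induct)
  case empty
  show ?case by (simp add: part_fps_def nat_coeffs_def)
next
  case (insert k K)
  define P S G Y where "P = part_fps K" and "S = (\<Sum>k\<in>K. (fps_X :: complex fps) ^ k)"
    and "G = fps_geom k" and "Y = (fps_X :: complex fps) ^ k"
  have e: "part_fps (insert k K) = G * P" "(\<Sum>k\<in>insert k K. (fps_X :: complex fps) ^ k) = Y + S"
    using insert by (simp_all add: part_fps_def P_def S_def G_def Y_def)
  have g: "(1 - Y) * G = 1" unfolding Y_def G_def by (rule fps_geom_mult) (use insert in auto)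
  have 1: "G * P * (Y + S) - G * P + 1 = (P * S - P + 1) + Y * (G * P) * S" using g by algebra
  have ih: "nat_coeffs (P * S - P + 1)" using insert by (auto simp: P_def S_def)
  have c: "nat_coeffs P" "nat_coeffs G" "nat_coeffs Y"
    unfolding P_def G_def Y_def by (intro nat_coeffs_part_fps nat_coeffs_geom nat_coeffs_intros)+
  have s: "nat_coeffs S" unfolding S_def
    by (auto simp: nat_coeffs_def fps_sum_nth fps_X_power_nth intro!: sum_in_Nats)
  show ?case unfolding e 1 by (intro nat_coeffs_intros ih c s)
qed

text \<open>Removing the largest part of a partition of \<open>n > 0\<close> injects these partitions into those
  of the smaller numbers.\<close>

lemma nat_coeffs_part_geom:
  assumes "finite K" "0 \<notin> K"
  shows "nat_coeffs (part_fps K * (fps_X * fps_geom 1) - part_fps K + 1)"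
proof -
  let ?S = "\<Sum>k\<in>K. (fps_X :: complex fps) ^ k"
  have "nat_coeffs (fps_X * fps_geom 1 - ?S)"
    unfolding nat_coeffs_def
  proof
    fix n
    have "fps_nth ?S n = (if n \<in> K then 1 else 0)"
      using assms(1) by (simp add: fps_sum_nth fps_X_power_nth)
    thus "fps_nth (fps_X * fps_geom 1 - ?S) n \<in> \<nat>"
      using assms(2) by (cases "n = 0") (auto simp: fps_geom_def)
  qed
  hence "nat_coeffs ((part_fps K * ?S - part_fps K + 1) + part_fps K * (fps_X * fps_geom 1 - ?S))"
    by (intro nat_coeffs_intros nat_coeffs_part_fps nat_coeffs_part_sum assms)
  thus ?thesis by (simp add: algebra_simps)
qed

text \<open>The partition of n into ones already accounts for one unit in each coefficient.\<close>

lemma nat_coeffs_part_minus_geom: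
  assumes "finite K" "1 \<in> K"
  shows "nat_coeffs (part_fps K - fps_geom 1)"
proof -
  have "part_fps K = fps_geom 1 * part_fps (K - {1})"
    unfolding part_fps_def using assms by (simp add: prod.remove)
  hence "part_fps K - fps_geom 1 = fps_geom 1 * (part_fps (K - {1}) - 1)" by (simp add: algebra_simps)
  thus ?thesis
    by (simp only:) (intro nat_coeffs_mult nat_coeffs_geom nat_coeffs_minus_1 nat_coeffs_part_fps part_fps_nth_0)
qed

subsection \<open>Coefficientwise limits\<close>

text \<open>Each coefficient converges in the usual topology of the complex numbers, since the
  limits are supplied by complex analysis. As the naturals are closed, nonnegativity still passes to
  the limit.\<close>

definition coeff_lim :: "(nat \<Rightarrow> complex fps) \<Rightarrow> complex fps \<Rightarrow> bool" where
  "coeff_lim F G \<longleftrightarrow> (\<forall>n. (\<lambda>m. fps_nth (F m) n) \<longlonglongrightarrow> fps_nth G n)"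

lemma coeff_lim_const: "coeff_lim (\<lambda>_. F) F"
  by (simp add: coeff_lim_def)

lemma coeff_lim_add: "coeff_lim F G \<Longrightarrow> coeff_lim F' G' \<Longrightarrow> coeff_lim (\<lambda>m. F m + F' m) (G + G')"
  by (auto simp: coeff_lim_def intro!: tendsto_intros)

lemma coeff_lim_diff: "coeff_lim F G \<Longrightarrow> coeff_lim F' G' \<Longrightarrow> coeff_lim (\<lambda>m. F m - F' m) (G - G')"
  by (auto simp: coeff_lim_def intro!: tendsto_intros)

lemma coeff_lim_mult: "coeff_lim F G \<Longrightarrow> coeff_lim F' G' \<Longrightarrow> coeff_lim (\<lambda>m. F m * F' m) (G * G')"
  by (auto simp: coeff_lim_def fps_mult_nth intro!: tendsto_intros)

text \<open>Solved for its last unknown, the convolution F F' = 1 writes each coefficient of F' as a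
  polynomial in coefficients of F and earlier ones of F', so convergence follows by strong
  induction.\<close>

lemma coeff_lim_inverse:
  assumes lim: "coeff_lim F G" and inv: "\<And>m. F m * F' m = 1" "G * G' = 1"
    and F0: "\<And>m. fps_nth (F m) 0 = 1" and G0: "fps_nth G 0 = 1"
  shows "coeff_lim F' G'"
  unfolding coeff_lim_def
proof
  have rec: "fps_nth B n = fps_nth 1 n - (\<Sum>i\<in>{1..n}. fps_nth A i * fps_nth B (n - i))"
    if "A * B = 1" "fps_nth A 0 = 1" for A B :: "complex fps" and n
  proof -
    have "fps_nth 1 n = (\<Sum>i=0..n. fps_nth A i * fps_nth B (n - i))"
      unfolding that(1)[symmetric] fps_mult_nth ..
    also have "\<dots> = fps_nth B n + (\<Sum>i\<in>{1..n}. fps_nth A i * fps_nth B (n - i))"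
      by (simp add: sum.atLeast_Suc_atMost that(2))
    finally show ?thesis by simp
  qed
  fix n
  show "(\<lambda>m. fps_nth (F' m) n) \<longlonglongrightarrow> fps_nth G' n"
  proof (induction n rule: less_induct)
    case (less n)
    have "(\<lambda>m. fps_nth 1 n - (\<Sum>i\<in>{1..n}. fps_nth (F m) i * fps_nth (F' m) (n - i))) \<longlonglongrightarrow>
       fps_nth 1 n - (\<Sum>i\<in>{1..n}. fps_nth G i * fps_nth G' (n - i))"
      using lim by (intro tendsto_intros less) (auto simp: coeff_lim_def)
    thus ?case unfolding rec[OF inv(1) F0, symmetric] rec[OF inv(2) G0, symmetric] .
  qed
qed

lemma nat_coeffs_lim:
  assumes "coeff_lim F G" "eventually (\<lambda>m. nat_coeffs (F m)) sequentially"
  shows "nat_coeffs G"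
  unfolding nat_coeffs_def
proof
  fix n
  have "eventually (\<lambda>m. fps_nth (F m) n \<in> \<nat>) sequentially"
    using assms(2) by eventually_elim (simp add: nat_coeffs_def)
  thus "fps_nth G n \<in> \<nat>"
    by (rule Lim_in_closed_set[OF closed_Nats]) (use assms(1) in \<open>auto simp: coeff_lim_def\<close>)
qed

section \<open>Taylor coefficients of the infinite products\<close>

lemma coeff_lim_poch5:
  assumes "a > 0"
  shows "coeff_lim (\<lambda>m. \<Prod>k<m. 1 - fps_X ^ (a + 5 * k)) (fps_expansion (poch5 a) 0)"
  unfolding coeff_lim_def
proof
  fix n
  define f where "f m q = (\<Prod>k<m. 1 - q ^ a * (q ^ 5) ^ k)" for m and q :: complex
  have u: "uniform_limit (ball 0 (1/2)) f (poch5 a) sequentially"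
    unfolding f_def by (rule uniform_limit_on_subset[OF uniform_limit_poch5[of "1/2"]]) (use assms in auto)
  have hol: "f m holomorphic_on A" for m A unfolding f_def by (intro holomorphic_intros)
  \<comment> \<open>Locally uniform convergence of holomorphic functions carries over to all
    derivatives at 0.\<close>
  have lim: "(\<lambda>m. (deriv ^^ n) (f m) 0) \<longlonglongrightarrow> (deriv ^^ n) (poch5 a) 0"
    by (rule higher_deriv_complex_uniform_limit[OF u]) (use hol in auto)
  have e: "f m has_fps_expansion (\<Prod>k<m. 1 - fps_X ^ (a + 5 * k))" for m
    unfolding f_def power_mult[symmetric] power_add[symmetric] by (intro fps_expansion_intros)
  have "(\<lambda>m. (deriv ^^ n) (f m) 0 / fact n) \<longlonglongrightarrow> (deriv ^^ n) (poch5 a) 0 / fact n"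
    by (intro tendsto_intros lim) auto
  thus "(\<lambda>m. fps_nth (\<Prod>k<m. 1 - fps_X ^ (a + 5 * k)) n) \<longlonglongrightarrow> fps_nth (fps_expansion (poch5 a) 0) n"
    by (simp add: fps_nth_fps_expansion[OF e] fps_expansion_def)
qed

definition arith_parts :: "nat \<Rightarrow> nat \<Rightarrow> nat \<Rightarrow> nat set" where
  "arith_parts a b m = (\<lambda>k. a + 5 * k) ` {..<m} \<union> (\<lambda>k. b + 5 * k) ` {..<m}"

lemma dist_fps_arith_parts:
  assumes "a < b" "b < 5"
  shows "dist_fps (arith_parts a b m) = (\<Prod>k<m. 1 - fps_X ^ (a + 5 * k)) * (\<Prod>k<m. 1 - fps_X ^ (b + 5 * k))"
proof -
  have "(a + 5 * k) mod 5 = a" "(b + 5 * k) mod 5 = b" for k using assms by auto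
  hence "(\<lambda>k. a + 5 * k) ` {..<m} \<inter> (\<lambda>k. b + 5 * k) ` {..<m} = {}" using assms by (auto; metis nat_neq_iff)
  thus ?thesis unfolding dist_fps_def arith_parts_def
    by (subst prod.union_disjoint) (auto simp: prod.reindex inj_on_def)
qed

text \<open>Stated for a general pair of residues so that (1,4) and (2,3) are both covered. It ties
  the analytic products to the finite partition series: the limit for f is a product of two, and
  that for 1/f follows by inverting coefficientwise.\<close>

lemma poch5_pair_expansions:
  assumes ab: "0 < a" "a < b" "b < 5" and f: "\<And>q. f q = poch5 a q * poch5 b q"
  shows "coeff_lim (\<lambda>m. dist_fps (arith_parts a b m)) (fps_expansion f 0)"
    and "coeff_lim (\<lambda>m. part_fps (arith_parts a b m)) (fps_expansion (\<lambda>q. inverse (f q)) 0)"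
    and "f has_fps_expansion fps_expansion f 0"
    and "(\<lambda>q. inverse (f q)) has_fps_expansion fps_expansion (\<lambda>q. inverse (f q)) 0"
    and "fps_nth (fps_expansion f 0) 0 = 1"
    and "fps_nth (fps_expansion (\<lambda>q. inverse (f q)) 0) 0 = 1"
    and "f holomorphic_on ball 0 1" and "(\<lambda>q. inverse (f q)) holomorphic_on ball 0 1"
proof -
  have f': "f = (\<lambda>q. poch5 a q * poch5 b q)" using f by auto
  have b0: "b > 0" using ab by auto
  show hf: "f holomorphic_on ball 0 1"
    unfolding f' by (intro holomorphic_intros holomorphic_poch5 ab b0)
  show hi: "(\<lambda>q. inverse (f q)) holomorphic_on ball 0 1"
    by (intro holomorphic_intros hf) (use ab in \<open>auto simp: f poch5_nonzero\<close>)
  have pe: "poch5 c has_fps_expansion fps_expansion (poch5 c) 0" if "c > 0" for c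
    by (rule has_fps_expansion_fps_expansion[OF _ _ holomorphic_poch5[OF that]]) auto
  show ef: "f has_fps_expansion fps_expansion f 0"
    by (rule has_fps_expansion_fps_expansion[OF _ _ hf]) auto
  show ei: "(\<lambda>q. inverse (f q)) has_fps_expansion fps_expansion (\<lambda>q. inverse (f q)) 0"
    by (rule has_fps_expansion_fps_expansion[OF _ _ hi]) auto
  have "f has_fps_expansion fps_expansion (poch5 a) 0 * fps_expansion (poch5 b) 0"
    unfolding f' by (intro fps_expansion_intros pe ab b0)
  hence "fps_expansion f 0 = fps_expansion (poch5 a) 0 * fps_expansion (poch5 b) 0"
    by (rule fps_expansion_eqI)
  thus lim: "coeff_lim (\<lambda>m. dist_fps (arith_parts a b m)) (fps_expansion f 0)"
    unfolding dist_fps_arith_parts[OF ab(2,3)] by (simp only:) (intro coeff_lim_mult coeff_lim_poch5 ab b0)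
  have f0: "f 0 = 1" using ab b0 by (simp add: f poch5_def qpoch_inf_def power_0_left)
  show nth0: "fps_nth (fps_expansion f 0) 0 = 1" "fps_nth (fps_expansion (\<lambda>q. inverse (f q)) 0) 0 = 1"
    using f0 by (simp_all add: fps_expansion_def)
  have "(\<lambda>q. f q * inverse (f q)) has_fps_expansion fps_expansion f 0 * fps_expansion (\<lambda>q. inverse (f q)) 0"
    by (intro fps_expansion_intros ef ei)
  moreover have "eventually (\<lambda>q. f q * inverse (f q) = 1) (nhds 0)"
  proof -
    have "eventually (\<lambda>q :: complex. q \<in> ball 0 1) (nhds 0)" by (rule eventually_nhds_in_open) auto
    thus ?thesis by eventually_elim (rule right_inverse, auto simp: f poch5_nonzero ab b0)
  qed
  ultimately have "(\<lambda>q. 1) has_fps_expansion fps_expansion f 0 * fps_expansion (\<lambda>q. inverse (f q)) 0"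
    by (subst (asm) has_fps_expansion_cong[OF _ refl])
  hence inv: "fps_expansion f 0 * fps_expansion (\<lambda>q. inverse (f q)) 0 = 1"
    using fps_expansion_unique_complex has_fps_expansion_1 by blast
  have "0 \<notin> arith_parts a b m" for m using ab by (auto simp: arith_parts_def)
  thus "coeff_lim (\<lambda>m. part_fps (arith_parts a b m)) (fps_expansion (\<lambda>q. inverse (f q)) 0)"
    by (intro coeff_lim_inverse[OF lim _ inv _ nth0(1)] dist_part_fps dist_fps_nth_0)
qed

section \<open>Nonnegativity and positivity for the Rogers-Ramanujan products\<close>

abbreviation alpha_fps :: "complex fps" where "alpha_fps \<equiv> fps_expansion alpha 0"
abbreviation A_fps :: "complex fps" where "A_fps \<equiv> fps_expansion (\<lambda>q. inverse (alpha q)) 0"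
abbreviation B_fps :: "complex fps" where "B_fps \<equiv> fps_expansion (\<lambda>q. inverse (beta q)) 0"

lemmas alpha_facts = poch5_pair_expansions[of 1 4 alpha, OF _ _ _ alpha_def, simplified]
lemmas beta_facts = poch5_pair_expansions[of 2 3 beta, OF _ _ _ beta_def, simplified]

lemma finite_arith_parts: "finite (arith_parts a b m)"
  by (simp add: arith_parts_def)

lemma zero_arith_parts: "a > 0 \<Longrightarrow> b > 0 \<Longrightarrow> 0 \<notin> arith_parts a b m"
  by (auto simp: arith_parts_def)

lemma nat_coeffs_A: "nat_coeffs A_fps" and nat_coeffs_B: "nat_coeffs B_fps"
  by (rule nat_coeffs_lim[OF alpha_facts(2)] nat_coeffs_lim[OF beta_facts(2)], simp add: nat_coeffs_part_fps)+

lemma nat_coeffs_A_minus_geom: "nat_coeffs (A_fps - fps_geom 1)"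
proof (rule nat_coeffs_lim[OF coeff_lim_diff[OF alpha_facts(2) coeff_lim_const]])
  have "nat_coeffs (part_fps (arith_parts 1 4 m) - fps_geom 1)" if "m \<ge> 1" for m
  proof (rule nat_coeffs_part_minus_geom[OF finite_arith_parts])
    have "1 + 5 * 0 \<in> arith_parts 1 4 m" unfolding arith_parts_def using that by (intro UnI1 image_eqI[of _ _ 0]) auto
    thus "1 \<in> arith_parts 1 4 m" by simp
  qed
  thus "\<forall>\<^sub>F m in sequentially. nat_coeffs (part_fps (arith_parts (Suc 0) 4 m) - fps_geom 1)"
    unfolding eventually_sequentially by auto
qed

text \<open>The sum of two bounds: a coefficient of alpha is at least minus that of A, and a
  coefficient of A is at most that of 1 + X A/(1 - X).\<close>

lemma nat_coeffs_alpha_bound: "nat_coeffs (alpha_fps + A_fps * (fps_X * fps_geom 1) + 1)"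
proof -
  have "nat_coeffs (A_fps + alpha_fps)"
    by (rule nat_coeffs_lim[OF coeff_lim_add[OF alpha_facts(2) alpha_facts(1)]])
       (use nat_coeffs_part_pm_dist finite_arith_parts zero_arith_parts in auto)
  moreover have "nat_coeffs (A_fps * (fps_X * fps_geom 1) - A_fps + 1)"
    by (rule nat_coeffs_lim[OF coeff_lim_add[OF coeff_lim_diff[OF coeff_lim_mult[OF alpha_facts(2) coeff_lim_const] alpha_facts(2)] coeff_lim_const]])
       (use nat_coeffs_part_geom finite_arith_parts zero_arith_parts in auto)
  ultimately have "nat_coeffs ((A_fps + alpha_fps) + (A_fps * (fps_X * fps_geom 1) - A_fps + 1))"
    by (rule nat_coeffs_add)
  thus ?thesis by (simp add: algebra_simps)
qed

text \<open>\<open>fps_geom 1\<close> has all coefficients equal to 1, so this says that all coefficients are positive integers.\<close>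

definition pos_coeffs :: "complex fps \<Rightarrow> bool" where
  "pos_coeffs F \<longleftrightarrow> nat_coeffs (F - fps_geom 1)"

lemma pos_coeffs_add: "pos_coeffs F \<Longrightarrow> nat_coeffs H \<Longrightarrow> pos_coeffs (F + H)"
  using nat_coeffs_add[of "F - fps_geom 1" H] by (simp add: pos_coeffs_def algebra_simps)

lemma pos_coeffs_imp_nat_coeffs: "pos_coeffs F \<Longrightarrow> nat_coeffs F"
  using nat_coeffs_add[OF _ nat_coeffs_geom[of 1], of "F - fps_geom 1"] by (simp add: pos_coeffs_def)

lemma pos_coeffs_mult:
  assumes "pos_coeffs F" "nat_coeffs H" "fps_nth H 0 = 1"
  shows "pos_coeffs (F * H)"
proof -
  have "nat_coeffs ((F - fps_geom 1) * H + fps_geom 1 * (H - 1))"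
    using assms by (intro nat_coeffs_intros nat_coeffs_minus_1 nat_coeffs_geom) (auto simp: pos_coeffs_def)
  thus ?thesis by (simp add: pos_coeffs_def algebra_simps)
qed

text \<open>One factor A makes every coefficient positive. Powers of B alone would not do, as they
  have no term of degree 1.\<close>

lemma pos_coeffs_A_B:
  assumes "m > 0"
  shows "pos_coeffs (A_fps ^ m * B_fps ^ n)"
proof -
  obtain k where k: "m = Suc k" using assms gr0_implies_Suc by blast
  have "pos_coeffs (A_fps * (A_fps ^ k * B_fps ^ n))"
  proof (rule pos_coeffs_mult)
    show "pos_coeffs A_fps" using nat_coeffs_A_minus_geom by (simp add: pos_coeffs_def)
    show "nat_coeffs (A_fps ^ k * B_fps ^ n)" by (intro nat_coeffs_intros nat_coeffs_A nat_coeffs_B)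
    show "fps_nth (A_fps ^ k * B_fps ^ n) 0 = 1" using alpha_facts(6) beta_facts(6) by (simp add: fps_nth_power_0)
  qed
  thus ?thesis by (simp add: k mult.assoc)
qed

lemma pos_coeffs_alpha: "pos_coeffs (alpha_fps + 8 * fps_X * A_fps ^ 5 * B_fps ^ 6)"
  unfolding pos_coeffs_def nat_coeffs_def
proof
  fix n
  let ?g = "fps_geom 1" and ?A = A_fps and ?B = B_fps
  have g: "?g = 1 + fps_X * ?g" using fps_geom_mult[of 1] by (simp add: algebra_simps)
  show "fps_nth (alpha_fps + 8 * fps_X * ?A ^ 5 * ?B ^ 6 - ?g) n \<in> \<nat>"
  proof (cases "n = 0")
    case True
    thus ?thesis using alpha_facts(5) by (simp add: fps_geom_def)
  next
    case False
    \<comment> \<open>Of the eight copies of X A^5 B^6, one pays for the X A/(1 - X) in the bound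
      for alpha, one provides the required X/(1 - X), and six are left over. The surplus constant 2
      affects only degree 0, which was treated separately.\<close>
    define T where "T = (alpha_fps + ?A * (fps_X * ?g) + 1) + fps_X * (?A * (?A ^ 4 * ?B ^ 6 - ?g) + (?A ^ 5 * ?B ^ 6 - ?g) + 6 * (?A ^ 5 * ?B ^ 6))"
    have "nat_coeffs (?A ^ 4 * ?B ^ 6 - ?g)" "nat_coeffs (?A ^ 5 * ?B ^ 6 - ?g)"
      using pos_coeffs_A_B[of 4 6] pos_coeffs_A_B[of 5 6] by (simp_all add: pos_coeffs_def)
    hence T: "nat_coeffs T"
      unfolding T_def by (intro nat_coeffs_add[OF nat_coeffs_alpha_bound] nat_coeffs_intros nat_coeffs_A nat_coeffs_B)
    have eq: "alpha_fps + 8 * fps_X * ?A ^ 5 * ?B ^ 6 - ?g = T - 2"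
      unfolding T_def using g by algebra
    show ?thesis using False T unfolding eq by (simp add: nat_coeffs_def fps_numeral_nth)
  qed
qed

lemma pos_coeffs_sums:
  assumes "f has_fps_expansion F" "f holomorphic_on ball 0 1" "pos_coeffs F"
  obtains c :: "nat \<Rightarrow> int" where "\<And>n. c n > 0"
    "\<And>q. norm q < 1 \<Longrightarrow> (\<lambda>n. of_int (c n) * q ^ n) sums f q"
proof -
  have "\<exists>k::nat. fps_nth F n = of_nat (Suc k)" for n
  proof -
    have "fps_nth (F - fps_geom 1) n \<in> \<nat>" using assms(3) by (simp add: pos_coeffs_def nat_coeffs_def)
    then obtain k where "fps_nth (F - fps_geom 1) n = of_nat k" by (auto elim: Nats_cases)
    thus ?thesis by (intro exI[of _ k]) (simp add: fps_geom_def algebra_simps)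
  qed
  then obtain k :: "nat \<Rightarrow> nat" where k: "\<And>n. fps_nth F n = of_nat (Suc (k n))" by metis
  show ?thesis
  proof
    show "int (Suc (k n)) > 0" for n by simp
    fix q :: complex assume "norm q < 1"
    hence "(\<lambda>n. fps_nth F n * q ^ n) sums f q"
      using assms by (intro has_fps_expansion_imp_sums_complex[where r = 1]) (auto simp: one_ereal_def)
    thus "(\<lambda>n. of_int (int (Suc (k n))) * q ^ n) sums f q" by (simp add: k)
  qed
qed

subsection \<open>The dissection\<close>

text \<open>The five residue classes of the quotient as functions of q^5, with the scalars -25, -5,
  5, -10, 5 removed so that all five are to have positive coefficients. Class 0 has also lost its
  constant term 1 and one factor q^5.\<close>

definition dissection :: "nat \<Rightarrow> complex \<Rightarrow> complex" where
  "dissection i q = (let A = inverse (alpha q); B = inverse (beta q) in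
     if i = 0 then A ^ 6 * B ^ 6
     else if i = 1 then A ^ 10 * B ^ 2 - 3 * q * (A ^ 5 * B ^ 7)
     else if i = 2 then 3 * (A ^ 9 * B ^ 3) + q * (A ^ 4 * B ^ 8)
     else if i = 3 then 3 * (A ^ 8 * B ^ 4) + q * (A ^ 3 * B ^ 9)
     else 8 * (A ^ 7 * B ^ 5) + q * (A ^ 2 * B ^ 10))"

text \<open>This form removes the minus sign. With x = \<open>rr_v q\<close> one has A^5 x = q B^5;
  replacing the leading 1 by (1 - 11 x - x^2) + 11 x + x^2 turns -3 into 8, and by
  \<open>rr_v_poly\<close> the product A^10 B^2 (1 - 11 x - x^2) is just B / A.\<close>

lemma dissection_1_eq:
  assumes "norm q < 1"
  shows "dissection 1 q = (alpha q + 8 * q * inverse (alpha q) ^ 5 * inverse (beta q) ^ 6) * inverse (beta q)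
    + q ^ 2 * inverse (beta q) ^ 12"
proof -
  define A B where "A = inverse (alpha q)" and "B = inverse (beta q)"
  have nz: "A \<noteq> 0" "B \<noteq> 0" "alpha q = inverse A" "beta q = inverse B"
    using alpha_nonzero[OF assms] beta_nonzero[OF assms] by (auto simp: A_def B_def)
  define x where "x = rr_v q"
  have "x = q * (B / A) ^ 5" unfolding x_def rr_v_def nz(3,4) using nz(1,2) by (simp add: field_simps)
  hence x: "A ^ 5 * x = q * B ^ 5" using nz(1) by (simp add: power_divide)
  have p: "1 - 11 * x - x ^ 2 = inverse A ^ 11 * inverse B" unfolding x_def rr_v_poly[OF assms] nz(3,4) ..
  have i: "A ^ 10 * B ^ 2 * (inverse A ^ 11 * inverse B) = inverse A * B"
    using nz(1,2) by (simp add: field_simps power_numeral_reduce)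
  have "dissection 1 q = A ^ 10 * B ^ 2 - 3 * q * (A ^ 5 * B ^ 7)" by (simp add: dissection_def A_def B_def Let_def)
  also have "\<dots> = A ^ 10 * B ^ 2 * (1 - 11 * x - x ^ 2) + 8 * (A ^ 5 * x) * A ^ 5 * B ^ 2 + (A ^ 5 * x) ^ 2 * B ^ 2"
    using x by algebra
  also have "\<dots> = (inverse A + 8 * q * A ^ 5 * B ^ 6) * B + q ^ 2 * B ^ 12"
    unfolding p i x by algebra
  finally show ?thesis unfolding A_def[symmetric] B_def[symmetric] unfolding nz(3) .
qed

lemma dissection_sums:
  assumes "i < 5"
  obtains c :: "nat \<Rightarrow> int" where "\<And>n. c n > 0"
    "\<And>q. norm q < 1 \<Longrightarrow> (\<lambda>n. of_int (c n) * q ^ n) sums dissection i q"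
proof -
  let ?A = A_fps and ?B = B_fps
  define A B where "A q = inverse (alpha q)" and "B q = inverse (beta q)" for q
  have AB: "A has_fps_expansion ?A" "B has_fps_expansion ?B" "A holomorphic_on ball 0 1" "B holomorphic_on ball 0 1"
    unfolding A_def B_def by (rule alpha_facts beta_facts)+
  note hol = holomorphic_intros alpha_facts(7) AB(3,4)
  note expa = fps_expansion_intros has_fps_expansion_power alpha_facts(3) AB(1,2)
  note nat = nat_coeffs_intros nat_coeffs_A nat_coeffs_B
  have num: "pos_coeffs (3 * F)" "pos_coeffs (8 * F)" if "pos_coeffs F" for F
    using pos_coeffs_add[OF that, of "2 * F"] pos_coeffs_add[OF that, of "7 * F"] pos_coeffs_imp_nat_coeffs[OF that]
    by (auto simp: nat_coeffs_intros)
  \<comment> \<open>The representing function need agree with \<open>dissection i\<close> only on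
    the unit disc, where the sign-free form for i = 1 is established.\<close>
  have "\<exists>f F. f has_fps_expansion F \<and> f holomorphic_on ball 0 1 \<and> pos_coeffs F \<and> (\<forall>q. norm q < 1 \<longrightarrow> dissection i q = f q)"
    (is ?P)
  proof -
    have ex: ?P if "f has_fps_expansion F" "f holomorphic_on ball 0 1" "pos_coeffs F"
      "\<And>q. norm q < 1 \<Longrightarrow> dissection i q = f q" for f F
      using that by blast
    consider "i = 0" | "i = 1" | "i = 2" | "i = 3" | "i = 4" using assms by linarith
    thus ?thesis
    proof cases
      case 1
      show ?thesis
      proof (rule ex)
        show "(\<lambda>q. A q ^ 6 * B q ^ 6) has_fps_expansion (?A ^ 6 * ?B ^ 6)" by (intro expa)
        show "(\<lambda>q. A q ^ 6 * B q ^ 6) holomorphic_on ball 0 1" by (intro hol)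
        show "pos_coeffs (?A ^ 6 * ?B ^ 6)" by (rule pos_coeffs_A_B) simp
      qed (simp add: 1 dissection_def Let_def A_def B_def)
    next
      case 2
      show ?thesis
      proof (rule ex)
        show "(\<lambda>q. (alpha q + 8 * q * A q ^ 5 * B q ^ 6) * B q + q ^ 2 * B q ^ 12) has_fps_expansion ((alpha_fps + 8 * fps_X * ?A ^ 5 * ?B ^ 6) * ?B + fps_X ^ 2 * ?B ^ 12)" by (intro expa)
        show "(\<lambda>q. (alpha q + 8 * q * A q ^ 5 * B q ^ 6) * B q + q ^ 2 * B q ^ 12) holomorphic_on ball 0 1" by (intro hol)
        show "pos_coeffs ((alpha_fps + 8 * fps_X * ?A ^ 5 * ?B ^ 6) * ?B + fps_X ^ 2 * ?B ^ 12)" by (intro pos_coeffs_add pos_coeffs_mult pos_coeffs_alpha nat beta_facts(6))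
      qed (simp add: 2 dissection_1_eq A_def B_def del: One_nat_def)
    next
      case 3
      show ?thesis
      proof (rule ex)
        show "(\<lambda>q. 3 * (A q ^ 9 * B q ^ 3) + q * (A q ^ 4 * B q ^ 8)) has_fps_expansion (3 * (?A ^ 9 * ?B ^ 3) + fps_X * (?A ^ 4 * ?B ^ 8))" by (intro expa)
        show "(\<lambda>q. 3 * (A q ^ 9 * B q ^ 3) + q * (A q ^ 4 * B q ^ 8)) holomorphic_on ball 0 1" by (intro hol)
        show "pos_coeffs (3 * (?A ^ 9 * ?B ^ 3) + fps_X * (?A ^ 4 * ?B ^ 8))" by (intro pos_coeffs_add num pos_coeffs_A_B nat) simp
      qed (simp add: 3 dissection_def Let_def A_def B_def)
    next
      case 4
      show ?thesis
      proof (rule ex)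
        show "(\<lambda>q. 3 * (A q ^ 8 * B q ^ 4) + q * (A q ^ 3 * B q ^ 9)) has_fps_expansion (3 * (?A ^ 8 * ?B ^ 4) + fps_X * (?A ^ 3 * ?B ^ 9))" by (intro expa)
        show "(\<lambda>q. 3 * (A q ^ 8 * B q ^ 4) + q * (A q ^ 3 * B q ^ 9)) holomorphic_on ball 0 1" by (intro hol)
        show "pos_coeffs (3 * (?A ^ 8 * ?B ^ 4) + fps_X * (?A ^ 3 * ?B ^ 9))" by (intro pos_coeffs_add num pos_coeffs_A_B nat) simp
      qed (simp add: 4 dissection_def Let_def A_def B_def)
    next
      case 5
      show ?thesis
      proof (rule ex)
        show "(\<lambda>q. 8 * (A q ^ 7 * B q ^ 5) + q * (A q ^ 2 * B q ^ 10)) has_fps_expansion (8 * (?A ^ 7 * ?B ^ 5) + fps_X * (?A ^ 2 * ?B ^ 10))" by (intro expa)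
        show "(\<lambda>q. 8 * (A q ^ 7 * B q ^ 5) + q * (A q ^ 2 * B q ^ 10)) holomorphic_on ball 0 1" by (intro hol)
        show "pos_coeffs (8 * (?A ^ 7 * ?B ^ 5) + fps_X * (?A ^ 2 * ?B ^ 10))" by (intro pos_coeffs_add num pos_coeffs_A_B nat) simp
      qed (simp add: 5 dissection_def Let_def A_def B_def)
    qed
  qed
  then obtain f F where f: "f has_fps_expansion F" "f holomorphic_on ball 0 1" "pos_coeffs F" "\<And>q. norm q < 1 \<Longrightarrow> dissection i q = f q"
    by blast
  from pos_coeffs_sums[OF f(1-3)] obtain c :: "nat \<Rightarrow> int" where c: "\<And>n. c n > 0"
    "\<And>q. norm q < 1 \<Longrightarrow> (\<lambda>n. of_int (c n) * q ^ n) sums f q" by blast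
  show ?thesis by (rule that[OF c(1)]) (use c(2) f(4) in auto)
qed

lemma rr_quotient_dissection:
  assumes "norm q < 1"
  shows "rogers_ramanujan_R q ^ 5 / rogers_ramanujan_R (q ^ 5) =
    (1 - 25 * q ^ 5 * dissection 0 (q ^ 5)) + q * (- 5 * dissection 1 (q ^ 5)) + q ^ 2 * (5 * dissection 2 (q ^ 5))
      + q ^ 3 * (- 10 * dissection 3 (q ^ 5)) + q ^ 4 * (5 * dissection 4 (q ^ 5))"
proof -
  have q5: "norm (q ^ 5) < 1" by (rule norm_power_less_1[OF assms]) simp
  define A B where "A = inverse (alpha (q ^ 5))" and "B = inverse (beta (q ^ 5))"
  have nz: "A \<noteq> 0" "B \<noteq> 0" "alpha (q ^ 5) = inverse A" "beta (q ^ 5) = inverse B"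
    using alpha_nonzero[OF q5] beta_nonzero[OF q5] by (auto simp: A_def B_def)
  define w where "w = rr_w q"
  have w: "w = q * B / A" unfolding w_def rr_w_def nz(3,4) using nz by (simp add: field_simps)
  have Aw: "A * w = q * B" using nz by (simp add: w)
  have p: "(1 - 11 * w ^ 5 - w ^ 10) * (A ^ 11 * B) = 1"
    unfolding w_def rr_w_poly_5[OF assms] nz(3,4) using nz(1,2) by (simp add: field_simps)
  have "rogers_ramanujan_R q ^ 5 / rogers_ramanujan_R (q ^ 5) = ratio_num w ^ 2 * (1 - w - w ^ 2) * (A ^ 11 * B)"
    unfolding rr_quotient_eq[OF assms] w_def[symmetric] nz(3,4) using nz(1,2) by (simp add: field_simps)
  \<comment> \<open>The terms are grouped by the exponent of w modulo 5, after splitting off 1 - 11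
    w^5 - w^10, which cancels the denominator and leaves the constant 1.\<close>
  also have "ratio_num w ^ 2 * (1 - w - w ^ 2) = (1 - 11 * w ^ 5 - w ^ 10) - 25 * w ^ 5 - 5 * w * (1 - 3 * w ^ 5)
     + 5 * w ^ 2 * (3 + w ^ 5) - 10 * w ^ 3 * (3 + w ^ 5) + 5 * w ^ 4 * (8 + w ^ 5)"
    unfolding ratio_num_def by algebra
  \<comment> \<open>The remaining exponents of w are at most 9, so A^11 suffices to complete each
    w^k to (A w)^k = (q B)^k. Thus w^k contributes exactly to the class of k modulo 5.\<close>
  also have "\<dots> * (A ^ 11 * B) = 1 - 25 * (A * w) ^ 5 * A ^ 6 * B - 5 * (A * w) * (A ^ 10 * B - 3 * (A * w) ^ 5 * A ^ 5 * B)
     + 5 * (A * w) ^ 2 * (3 * A ^ 9 * B + (A * w) ^ 5 * A ^ 4 * B) - 10 * (A * w) ^ 3 * (3 * A ^ 8 * B + (A * w) ^ 5 * A ^ 3 * B)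
     + 5 * (A * w) ^ 4 * (8 * A ^ 7 * B + (A * w) ^ 5 * A ^ 2 * B)"
    using p by algebra
  also have "\<dots> = (1 - 25 * q ^ 5 * (A ^ 6 * B ^ 6)) + q * (- 5 * (A ^ 10 * B ^ 2 - 3 * q ^ 5 * (A ^ 5 * B ^ 7)))
      + q ^ 2 * (5 * (3 * (A ^ 9 * B ^ 3) + q ^ 5 * (A ^ 4 * B ^ 8)))
      + q ^ 3 * (- 10 * (3 * (A ^ 8 * B ^ 4) + q ^ 5 * (A ^ 3 * B ^ 9))) + q ^ 4 * (5 * (8 * (A ^ 7 * B ^ 5) + q ^ 5 * (A ^ 2 * B ^ 10)))"
    unfolding Aw by algebra
  finally show ?thesis by (simp add: dissection_def Let_def A_def B_def)
qed

section \<open>Assembling the coefficients \<open>C n\<close>\<close>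

lemma sums_residue_class:
  fixes q s :: complex and d :: "nat \<Rightarrow> complex"
  assumes "(\<lambda>k. d k * (q ^ 5) ^ k) sums s" "i < 5"
  shows "(\<lambda>n. if n mod 5 = i then d (n div 5) * q ^ n else 0) sums (q ^ i * s)"
proof -
  let ?f = "\<lambda>n. if n mod 5 = i then d (n div 5) * q ^ n else 0"
  have mono: "strict_mono (\<lambda>k. 5 * k + i)" by (auto simp: strict_mono_def)
  have zero: "?f n = 0" if "n \<notin> range (\<lambda>k. 5 * k + i)" for n
  proof -
    have "n mod 5 \<noteq> i"
    proof
      assume "n mod 5 = i"
      hence "n = 5 * (n div 5) + i" using mult_div_mod_eq[of 5 n] by simp
      thus False using that by blast
    qed
    thus ?thesis by simp
  qed
  have "(\<lambda>k. q ^ i * (d k * (q ^ 5) ^ k)) sums (q ^ i * s)" by (intro sums_mult assms)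
  moreover have "q ^ i * (d k * (q ^ 5) ^ k) = ?f (5 * k + i)" for k
    using assms(2) by (simp add: power_add power_mult)
  ultimately have "(\<lambda>k. ?f (5 * k + i)) sums (q ^ i * s)" by simp
  thus ?thesis using sums_mono_reindex[of "\<lambda>k. 5 * k + i" ?f "q ^ i * s", OF mono zero] by blast
qed

text \<open>Resolves the definite description: two coefficient sequences that sum to the same
  function on the disc are expansions of one function at 0, hence equal.\<close>

lemma C_eqI:
  assumes c: "\<And>q :: complex. norm q < 1 \<Longrightarrow> (\<lambda>n. of_int (c n) * q ^ n) sums
            (rogers_ramanujan_R q ^ 5 / rogers_ramanujan_R (q ^ 5))"
  shows "C = c"
  unfolding C_def
proof (rule the_equality)
  show "\<forall>q::complex. norm q < 1 \<longrightarrow> (\<lambda>n. of_int (c n) * q ^ n) sums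
            (rogers_ramanujan_R q ^ 5 / rogers_ramanujan_R (q ^ 5))" using c by blast
  fix d assume d: "\<forall>q::complex. norm q < 1 \<longrightarrow> (\<lambda>n. of_int (d n) * q ^ n) sums
            (rogers_ramanujan_R q ^ 5 / rogers_ramanujan_R (q ^ 5))"
  let ?f = "\<lambda>q. rogers_ramanujan_R q ^ 5 / rogers_ramanujan_R (q ^ 5)"
  have ex: "?f has_fps_expansion Abs_fps (\<lambda>n. of_int (e n))"
    if "\<And>q. norm q < 1 \<Longrightarrow> (\<lambda>n. of_int (e n) * q ^ n) sums ?f q" for e :: "nat \<Rightarrow> int"
  proof (rule has_fps_expansionI)
    have "eventually (\<lambda>q::complex. q \<in> ball 0 1) (nhds 0)" by (rule eventually_nhds_in_open) auto
    thus "\<forall>\<^sub>F u in nhds 0. (\<lambda>n. fps_nth (Abs_fps (\<lambda>n. of_int (e n))) n * u ^ n) sums ?f u"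
      by eventually_elim (use that in auto)
  qed
  have "Abs_fps (\<lambda>n. complex_of_int (d n)) = Abs_fps (\<lambda>n. of_int (c n))"
    by (rule fps_expansion_unique_complex[OF ex ex]) (use c d in auto)
  thus "d = c" by (simp add: fps_eq_iff fun_eq_iff)
qed

theorem theorem1p4:
  shows "C 0 = 1 \<and>
    (\<forall>n::nat.
       (n \<noteq> 0 \<longrightarrow> C (5 * n) < 0) \<and>
       C (5 * n + 1) < 0 \<and>
       C (5 * n + 2) > 0 \<and>
       C (5 * n + 3) < 0 \<and>
       C (5 * n + 4) > 0)"
proof -
  have "\<exists>c :: nat \<Rightarrow> int. (\<forall>n. c n > 0) \<and> (\<forall>q. norm q < 1 \<longrightarrow> (\<lambda>n. of_int (c n) * q ^ n) sums dissection i q)" if "i < 5" for i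
    using dissection_sums[OF that] by metis
  then obtain c :: "nat \<Rightarrow> nat \<Rightarrow> int" where pos: "\<And>i n. i < 5 \<Longrightarrow> c i n > 0"
    and c: "\<And>i q. i < 5 \<Longrightarrow> norm q < 1 \<Longrightarrow> (\<lambda>n. of_int (c i n) * q ^ n) sums dissection i q"
    by metis
  \<comment> \<open>The coefficient at 5 k + i. For i = 0 the factor q^5 in front of the class
    shifts the index by one, and the place k = 0 receives the exceptional value 1.\<close>
  define d :: "nat \<Rightarrow> nat \<Rightarrow> int" where "d i k = (if i = 0 then (if k = 0 then 1 else - 25 * c 0 (k - 1))
     else if i = 1 then - 5 * c 1 k else if i = 2 then 5 * c 2 k else if i = 3 then - 10 * c 3 k else 5 * c 4 k)" for i k
  have C_eq: "C = (\<lambda>n. d (n mod 5) (n div 5))"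
  proof (rule C_eqI)
    fix q :: complex assume q: "norm q < 1"
    have q5: "norm (q ^ 5) < 1" by (rule norm_power_less_1[OF q]) simp
    define Q where "Q = q ^ 5"
    have m: "(\<lambda>k. of_int (a * c i k) * Q ^ k) sums (of_int a * dissection i Q)" if "i < 5" for a i
      using sums_mult[OF c[OF that q5], of "of_int a"] by (simp add: mult_ac Q_def)
    have "(\<lambda>k. Q * (of_int (- 25 * c 0 k) * Q ^ k)) sums (Q * (of_int (- 25) * dissection 0 Q))"
      by (intro sums_mult m) simp
    hence "(\<lambda>k. of_int (d 0 (Suc k)) * Q ^ Suc k) sums (Q * (of_int (- 25) * dissection 0 Q))"
      by (simp add: d_def mult_ac)
    hence 0: "(\<lambda>k. of_int (d 0 k) * Q ^ k) sums (1 - 25 * Q * dissection 0 Q)"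
      by (subst (asm) sums_Suc_iff) (simp add: d_def mult_ac)
    let ?t = "\<lambda>i n. if n mod 5 = i then of_int (d i (n div 5)) * q ^ n else 0"
    have "(\<lambda>n. ?t 0 n + ?t 1 n + ?t 2 n + ?t 3 n + ?t 4 n) sums
       (q ^ 0 * (1 - 25 * Q * dissection 0 Q) + q ^ 1 * (- 5 * dissection 1 Q) + q ^ 2 * (5 * dissection 2 Q)
      + q ^ 3 * (- 10 * dissection 3 Q) + q ^ 4 * (5 * dissection 4 Q))"
      using 0 m[of 1 "- 5"] m[of 2 5] m[of 3 "- 10"] m[of 4 5]
      by (intro sums_add sums_residue_class[where q = q, folded Q_def]) (simp_all add: d_def)
    moreover have "?t 0 n + ?t 1 n + ?t 2 n + ?t 3 n + ?t 4 n = of_int (d (n mod 5) (n div 5)) * q ^ n" for n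
    proof -
      have "n mod 5 < 5" by simp
      hence "n mod 5 \<in> {0, 1, 2, 3, 4}" by auto
      thus ?thesis by auto
    qed
    ultimately show "(\<lambda>n. of_int (d (n mod 5) (n div 5)) * q ^ n) sums
            (rogers_ramanujan_R q ^ 5 / rogers_ramanujan_R (q ^ 5))"
      unfolding rr_quotient_dissection[OF q] by (simp add: Q_def)
  qed
  have C: "C (5 * n + i) = d i n" if "i < 5" for i n
  proof -
    have "(5 * n + i) mod 5 = i" "(5 * n + i) div 5 = n" using that by simp_all
    thus ?thesis unfolding C_eq by (simp only:)
  qed
  show ?thesis
  proof (intro conjI allI impI)
    show "C 0 = 1" using C[of 0 0] by (simp add: d_def)
    fix n :: nat
    show "C (5 * n) < 0" if "n \<noteq> 0" using C[of 0 n] pos[of 0 "n - 1"] that by (simp add: d_def)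
    show "C (5 * n + 1) < 0" using C[of 1 n] pos[of 1 n] by (simp add: d_def)
    show "C (5 * n + 2) > 0" using C[of 2 n] pos[of 2 n] by (simp add: d_def)
    show "C (5 * n + 3) < 0" using C[of 3 n] pos[of 3 n] by (simp add: d_def)
    show "C (5 * n + 4) > 0" using C[of 4 n] pos[of 4 n] by (simp add: d_def)
  qed
qed

end
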